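(* Let $p \geq 5$ be a prime number and let $c_1, c_2$ be positive constants. Then there is a constant $X_0 > 0$ such that the following holds for every real number $X \geq X_0$. Let $q$ be a prime number with $$c_1 X^{\frac{p-2}{2p(p-1)}} < q < c_2 X^{\frac{p-2}{2p(p-1)}},$$ and let $a$ and $b$ be integers with $$\frac{1}{2p}\, q^{\frac{p}{p-2}} < a, b < \left(\frac{1}{2p} + \frac{1}{2^p p^p}\right) q^{\frac{p}{p-2}}.$$ Put $$f_q(a,b) = 2(a^p + b^p) q^p - (a-b)^2 q^{2p} - g(a,b)^2, \qquad g(a,b) = \frac{a^p - b^p}{a - b}.$$ If $f_q(a,b) \geq 4 a b^{\frac{p-1}{2}} q^{\frac{p+1}{2}}$ and $f_q(a,b)$ is square-free, then the ideal class group of the imaginary quadratic field $\mathbb{Q}(\sqrt{-f_q(a,b)})$ contains a subgroup isomorphic to $\mathbb{Z}/p\mathbb{Z} \times \mathbb{Z}/p\mathbb{Z}$.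
   Context: The expression $g(a,b) = \frac{a^p - b^p}{a-b}$ is understood as the polynomial $a^{p-1} + a^{p-2} b + \cdots + a b^{p-2} + b^{p-1}$ (so that it also makes sense for $a = b$). An integer is square-free if it is not divisible by the square of any prime. *)

theory Defs
  imports
    "HOL-Computational_Algebra.Computational_Algebra"
    "HOL-Algebra.Algebra"
    "HOL-Algebra.Algebraic_Closure_Type"
begin

definition nonzero_ideals :: "('a, 'b) ring_scheme \<Rightarrow> 'a set set" where
  "nonzero_ideals R = {I. ideal I R \<and> I \<noteq> {\<zero>\<^bsub>R\<^esub>}}"

text \<open>Two nonzero ideals \<open>I\<close>, \<open>J\<close> are equivalent iff \<open>aI = bJ\<close> for some nonzero ring
  elements \<open>a\<close>, \<open>b\<close>, i.e. iff they differ by a principal fractional ideal.\<close>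

definition ideal_class_rel :: "('a, 'b) ring_scheme \<Rightarrow> ('a set \<times> 'a set) set" where
  "ideal_class_rel R = {(I, J). I \<in> nonzero_ideals R \<and> J \<in> nonzero_ideals R \<and>
     (\<exists>a \<in> carrier R - {\<zero>\<^bsub>R\<^esub>}. \<exists>b \<in> carrier R - {\<zero>\<^bsub>R\<^esub>}.
        (PIdl\<^bsub>R\<^esub> a) \<cdot>\<^bsub>R\<^esub> I = (PIdl\<^bsub>R\<^esub> b) \<cdot>\<^bsub>R\<^esub> J)}"

text \<open>The product of two classes is the class of \<open>I \<cdot> J\<close> for any representatives \<open>I\<close>, \<open>J\<close>;
  the union below is a union of equal sets (see \<open>class_mult\<close>).
  Over any domain this is a commutative monoid; it is a group over a Dedekind domain, such as
  a ring of integers.\<close>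

definition ideal_class_group :: "('a, 'b) ring_scheme \<Rightarrow> 'a set set monoid" where
  "ideal_class_group R =
     \<lparr> carrier = nonzero_ideals R // ideal_class_rel R,
       monoid.mult = (\<lambda>A B. \<Union>I\<in>A. \<Union>J\<in>B. ideal_class_rel R `` {I \<cdot>\<^bsub>R\<^esub> J}),
       one = ideal_class_rel R `` {carrier R} \<rparr>"

context "domain"
begin

lemma ideal_prod_nonzero:
  assumes "I \<in> nonzero_ideals R" "J \<in> nonzero_ideals R"
  shows "I \<cdot> J \<in> nonzero_ideals R"
proof -
  have I: "ideal I R" and J: "ideal J R" using assms by (auto simp: nonzero_ideals_def)
  have "\<zero> \<in> I" "\<zero> \<in> J"
    using I J additive_subgroup.zero_closed ideal.axioms(1) by blast+
  then obtain x y where x: "x \<in> I" "x \<noteq> \<zero>" and y: "y \<in> J" "y \<noteq> \<zero>"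
    using assms unfolding nonzero_ideals_def by blast
  have "x \<otimes> y \<in> I \<cdot> J" using x y by (intro ideal_prod.prod)
  moreover have "x \<otimes> y \<noteq> \<zero>"
    using x y ideal.Icarr[OF I] ideal.Icarr[OF J] integral by blast
  ultimately show ?thesis
    using ideal_prod_is_ideal[OF I J] by (auto simp: nonzero_ideals_def)
qed

lemma PIdl_nonzero:
  assumes "a \<in> carrier R - {\<zero>}"
  shows "(PIdl a) \<in> nonzero_ideals R"
  using assms cgenideal_ideal cgenideal_self unfolding nonzero_ideals_def by blast

lemma PIdl_prod:
  assumes "a \<in> carrier R" "b \<in> carrier R"
  shows "(PIdl a) \<cdot> (PIdl b) = (PIdl (a \<otimes> b))"
proof -
  have I: "ideal (PIdl (a \<otimes> b)) R"
    using assms cgenideal_ideal by simp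
  have "(PIdl a) \<cdot> (PIdl b) = Idl (PIdl (a \<otimes> b))"
    using assms by (simp only: ideal_prod_eq_genideal cgenideal_ideal cgenideal_prod)
  also have "\<dots> = PIdl (a \<otimes> b)"
  proof (rule antisym)
    show "Idl (PIdl (a \<otimes> b)) \<subseteq> PIdl (a \<otimes> b)"
      by (rule genideal_minimal[OF I order_refl])
    show "PIdl (a \<otimes> b) \<subseteq> Idl (PIdl (a \<otimes> b))"
      using ideal.Icarr[OF I] by (intro genideal_self subsetI)
  qed
  finally show ?thesis .
qed

lemma ideal_class_relE:
  assumes "(I, J) \<in> ideal_class_rel R"
  obtains a b where "I \<in> nonzero_ideals R" "J \<in> nonzero_ideals R"
    "ideal I R" "ideal J R" "a \<in> carrier R - {\<zero>}" "b \<in> carrier R - {\<zero>}"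
    "(PIdl a) \<cdot> I = (PIdl b) \<cdot> J"
proof -
  have "I \<in> nonzero_ideals R \<and> J \<in> nonzero_ideals R \<and>
     (\<exists>a \<in> carrier R - {\<zero>}. \<exists>b \<in> carrier R - {\<zero>}. (PIdl a) \<cdot> I = (PIdl b) \<cdot> J)"
    using assms unfolding ideal_class_rel_def by (simp only: mem_Collect_eq case_prod_conv)
  then show ?thesis
    using that by (auto simp only: nonzero_ideals_def mem_Collect_eq)
qed

lemma ideal_class_relI:
  assumes "I \<in> nonzero_ideals R" "J \<in> nonzero_ideals R"
    "a \<in> carrier R - {\<zero>}" "b \<in> carrier R - {\<zero>}"
    "(PIdl a) \<cdot> I = (PIdl b) \<cdot> J"
  shows "(I, J) \<in> ideal_class_rel R"
  unfolding ideal_class_rel_def mem_Collect_eq case_prod_conv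
  by (intro conjI bexI) (fact assms)+

lemma carrier_nonzero_ideal: "carrier R \<in> nonzero_ideals R"
  using oneideal one_closed one_not_zero unfolding nonzero_ideals_def by blast

lemma equiv_ideal_class_rel: "equiv (nonzero_ideals R) (ideal_class_rel R)"
proof (rule equivI)
  show "ideal_class_rel R \<subseteq> nonzero_ideals R \<times> nonzero_ideals R"
    by (auto simp: ideal_class_rel_def)
  show "refl_on (nonzero_ideals R) (ideal_class_rel R)"
  proof (rule refl_onI)
    fix I assume "I \<in> nonzero_ideals R"
    moreover have "\<one> \<in> carrier R - {\<zero>}" using one_not_zero by simp
    ultimately show "(I, I) \<in> ideal_class_rel R"
      unfolding ideal_class_rel_def by blast
  qed
  show "sym (ideal_class_rel R)"
    by (rule symI, erule ideal_class_relE, rule ideal_class_relI) (assumption | erule sym)+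
  show "trans (ideal_class_rel R)"
  proof (rule transI)
    fix I J K assume IJ: "(I, J) \<in> ideal_class_rel R" and JK: "(J, K) \<in> ideal_class_rel R"
    from IJ obtain a b where I: "ideal I R" "I \<in> nonzero_ideals R" and J: "ideal J R"
      and ab: "a \<in> carrier R - {\<zero>}" "b \<in> carrier R - {\<zero>}"
      and e1: "(PIdl a) \<cdot> I = (PIdl b) \<cdot> J"
      by (elim ideal_class_relE)
    from JK obtain c d where K: "ideal K R" "K \<in> nonzero_ideals R"
      and cd: "c \<in> carrier R - {\<zero>}" "d \<in> carrier R - {\<zero>}"
      and e2: "(PIdl c) \<cdot> J = (PIdl d) \<cdot> K"
      by (elim ideal_class_relE)
    note abcd = ab cd
    have P: "ideal (PIdl a) R" "ideal (PIdl b) R" "ideal (PIdl c) R" "ideal (PIdl d) R"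
      using abcd cgenideal_ideal by auto
    have "(PIdl (c \<otimes> a)) \<cdot> I = (PIdl c) \<cdot> ((PIdl a) \<cdot> I)"
      using abcd P I by (simp add: PIdl_prod[symmetric] ideal_prod_assoc)
    also have "\<dots> = ((PIdl c) \<cdot> (PIdl b)) \<cdot> J"
      using P J e1 by (simp add: ideal_prod_assoc)
    also have "\<dots> = ((PIdl b) \<cdot> (PIdl c)) \<cdot> J"
      using P by (simp add: ideal_prod_commute)
    also have "\<dots> = (PIdl b) \<cdot> ((PIdl d) \<cdot> K)"
      using P J e2 by (simp add: ideal_prod_assoc)
    also have "\<dots> = (PIdl (b \<otimes> d)) \<cdot> K"
      using abcd P K by (simp add: PIdl_prod[symmetric] ideal_prod_assoc)
    finally have "(PIdl (c \<otimes> a)) \<cdot> I = (PIdl (b \<otimes> d)) \<cdot> K" .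
    moreover have "c \<otimes> a \<in> carrier R - {\<zero>}" "b \<otimes> d \<in> carrier R - {\<zero>}"
      using abcd integral by blast+
    ultimately show "(I, K) \<in> ideal_class_rel R"
      using I K by (intro ideal_class_relI)
  qed
qed

lemma ideal_class_rel_prod:
  assumes "(I, I') \<in> ideal_class_rel R" "(J, J') \<in> ideal_class_rel R"
  shows "(I \<cdot> J, I' \<cdot> J') \<in> ideal_class_rel R"
proof -
  from assms(1) obtain a b where 1: "ideal I R" "ideal I' R"
    "I \<in> nonzero_ideals R" "I' \<in> nonzero_ideals R"
    and ab: "a \<in> carrier R - {\<zero>}" "b \<in> carrier R - {\<zero>}"
    and e1: "(PIdl a) \<cdot> I = (PIdl b) \<cdot> I'"
    by (elim ideal_class_relE)
  from assms(2) obtain c d where 2: "ideal J R" "ideal J' R"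
    "J \<in> nonzero_ideals R" "J' \<in> nonzero_ideals R"
    and cd: "c \<in> carrier R - {\<zero>}" "d \<in> carrier R - {\<zero>}"
    and e2: "(PIdl c) \<cdot> J = (PIdl d) \<cdot> J'"
    by (elim ideal_class_relE)
  note i = 1(1,2) 2(1,2) and abcd = ab cd and e = e1 e2
  have P: "ideal (PIdl a) R" "ideal (PIdl b) R" "ideal (PIdl c) R" "ideal (PIdl d) R"
    using abcd cgenideal_ideal by auto
  have swap: "(A \<cdot> B) \<cdot> (C \<cdot> D) = (A \<cdot> C) \<cdot> (B \<cdot> D)"
    if "ideal A R" "ideal B R" "ideal C R" "ideal D R" for A B C D
  proof -
    have "(A \<cdot> B) \<cdot> (C \<cdot> D) = A \<cdot> ((B \<cdot> C) \<cdot> D)"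
      using that by (simp add: ideal_prod_assoc ideal_prod_is_ideal)
    also have "\<dots> = A \<cdot> ((C \<cdot> B) \<cdot> D)"
      using that by (simp add: ideal_prod_commute)
    also have "\<dots> = (A \<cdot> C) \<cdot> (B \<cdot> D)"
      using that by (simp add: ideal_prod_assoc ideal_prod_is_ideal)
    finally show ?thesis .
  qed
  have "(PIdl (a \<otimes> c)) \<cdot> (I \<cdot> J) = ((PIdl a) \<cdot> I) \<cdot> ((PIdl c) \<cdot> J)"
    using abcd P i by (simp add: PIdl_prod[symmetric] swap)
  also have "\<dots> = (PIdl (b \<otimes> d)) \<cdot> (I' \<cdot> J')"
    using abcd P i e by (simp add: PIdl_prod[symmetric] swap)
  finally have "(PIdl (a \<otimes> c)) \<cdot> (I \<cdot> J) = (PIdl (b \<otimes> d)) \<cdot> (I' \<cdot> J')" .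
  moreover have "a \<otimes> c \<in> carrier R - {\<zero>}" "b \<otimes> d \<in> carrier R - {\<zero>}"
    using abcd integral by blast+
  ultimately show ?thesis
    using 1 2 by (intro ideal_class_relI ideal_prod_nonzero)
qed

lemma class_mult:
  assumes "I \<in> nonzero_ideals R" "J \<in> nonzero_ideals R"
  shows "(ideal_class_rel R `` {I}) \<otimes>\<^bsub>ideal_class_group R\<^esub> (ideal_class_rel R `` {J}) =
         ideal_class_rel R `` {I \<cdot> J}"
proof -
  have "congruent2 (ideal_class_rel R) (ideal_class_rel R)
          (\<lambda>I J. ideal_class_rel R `` {I \<cdot> J})"
    unfolding congruent2_def
    using equiv_class_eq[OF equiv_ideal_class_rel] ideal_class_rel_prod by blast
  then show ?thesis
    using UN_equiv_class2[OF equiv_ideal_class_rel equiv_ideal_class_rel _ assms]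
    by (simp add: ideal_class_group_def)
qed

lemma comm_monoid_ideal_class_group: "comm_monoid (ideal_class_group R)"
proof -
  have carr: "carrier (ideal_class_group R) = (\<lambda>I. ideal_class_rel R `` {I}) ` nonzero_ideals R"
    by (auto simp: ideal_class_group_def quotient_def)
  have one: "\<one>\<^bsub>ideal_class_group R\<^esub> = ideal_class_rel R `` {carrier R}"
    by (simp add: ideal_class_group_def)
  have nzI: "I \<in> nonzero_ideals R \<Longrightarrow> ideal I R" for I
    by (simp add: nonzero_ideals_def)
  show ?thesis
  proof (rule comm_monoidI)
    fix x y z
    assume "x \<in> carrier (ideal_class_group R)" "y \<in> carrier (ideal_class_group R)"
    then show "x \<otimes>\<^bsub>ideal_class_group R\<^esub> y \<in> carrier (ideal_class_group R)"
      unfolding carr by (auto simp: class_mult ideal_prod_nonzero)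
  next
    show "\<one>\<^bsub>ideal_class_group R\<^esub> \<in> carrier (ideal_class_group R)"
      unfolding carr one using carrier_nonzero_ideal by blast
  next
    fix x y z
    assume "x \<in> carrier (ideal_class_group R)" "y \<in> carrier (ideal_class_group R)"
      "z \<in> carrier (ideal_class_group R)"
    then show "x \<otimes>\<^bsub>ideal_class_group R\<^esub> y \<otimes>\<^bsub>ideal_class_group R\<^esub> z =
               x \<otimes>\<^bsub>ideal_class_group R\<^esub> (y \<otimes>\<^bsub>ideal_class_group R\<^esub> z)"
      unfolding carr by (auto simp: class_mult ideal_prod_nonzero ideal_prod_assoc nzI)
  next
    fix x assume "x \<in> carrier (ideal_class_group R)"
    then show "\<one>\<^bsub>ideal_class_group R\<^esub> \<otimes>\<^bsub>ideal_class_group R\<^esub> x = x"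
      unfolding carr one
      by (auto simp: class_mult carrier_nonzero_ideal ideal_prod_commute[OF oneideal]
            ideal_prod_one nzI)
  next
    fix x y
    assume "x \<in> carrier (ideal_class_group R)" "y \<in> carrier (ideal_class_group R)"
    then show "x \<otimes>\<^bsub>ideal_class_group R\<^esub> y = y \<otimes>\<^bsub>ideal_class_group R\<^esub> x"
      unfolding carr by (auto simp: class_mult ideal_prod_commute nzI)
  qed
qed

end

definition quadratic_field :: "int \<Rightarrow> complex set" where
  "quadratic_field d =
     generate_field (ring_of_type_algebra :: complex ring) {csqrt (of_int d)}"

definition ring_of_integers :: "complex set \<Rightarrow> complex ring" where
  "ring_of_integers K = ring_of_type_algebra\<lparr>carrier := {x \<in> K. algebraic_int x}\<rparr>"

text \<open>\<open>g(a,b) = (a^p - b^p) / (a - b)\<close> as a polynomial, so that \<open>a = b\<close> is allowed.\<close>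

definition g_poly :: "nat \<Rightarrow> int \<Rightarrow> int \<Rightarrow> int" where
  "g_poly p a b = (\<Sum>i<p. a ^ (p - 1 - i) * b ^ i)"

definition f_poly :: "nat \<Rightarrow> nat \<Rightarrow> int \<Rightarrow> int \<Rightarrow> int" where
  "f_poly p q a b =
     2 * (a ^ p + b ^ p) * int q ^ p - (a - b)\<^sup>2 * int q ^ (2 * p) - (g_poly p a b)\<^sup>2"

end

theory Submission
  imports Defs
begin

text \<open>Write \<open>f\<close> for \<open>f_q(a,b)\<close>. Since \<open>(a - b) g = a\<^sup>p - b\<^sup>p\<close>, one has
  \<open>f = 4 (aq)\<^sup>p - s\<^sup>2 = 4 (bq)\<^sup>p - t\<^sup>2\<close> with \<open>s = (a - b) q\<^sup>p + g\<close> and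
  \<open>t = (a - b) q\<^sup>p - g\<close>, so the integers \<open>x = (s + \<surd>-f) / 2\<close> and \<open>y = (t + \<surd>-f) / 2\<close>
  have norms \<open>(aq)\<^sup>p\<close> and \<open>(bq)\<^sup>p\<close>. As \<open>f\<close> is square-free, both are coprime to their
  conjugates, hence \<open>I = (aq, x)\<close> and \<open>J = (bq, y)\<close> satisfy \<open>I\<^sup>p = (x)\<close> and \<open>J\<^sup>p = (y)\<close>.

  If \<open>I J\<^sup>k\<close> (or \<open>I\<close> times the \<open>k\<close>-th power of the conjugate of \<open>J\<close>) were principal with
  \<open>k \<le> (p - 1) / 2\<close>, its generator would have norm at most \<open>f / 4\<close> and so be a rational integer;
  then \<open>x y\<^sup>k\<close> is associated to its conjugate, so \<open>y\<close> divides the conjugate of \<open>x\<close> and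
  \<open>b\<close> divides \<open>a\<close>, contradicting the coprimality of \<open>s\<close> and \<open>aq\<close>.
  The size of \<open>X\<close> matters only in that it forces \<open>a, b \<ge> 2\<close>.\<close>

subsection \<open>Pairs of independent elements of prime order in a commutative monoid\<close>

lemma (in comm_monoid) nat_pow_mod:
  assumes "x \<in> carrier G" "x [^] (p::nat) = \<one>"
  shows "x [^] (n mod p) = x [^] n"
proof -
  have "x [^] n = x [^] (p * (n div p) + n mod p)" by simp
  also have "\<dots> = x [^] (p * (n div p)) \<otimes> x [^] (n mod p)"
    using assms(1) by (simp only: nat_pow_mult)
  also have "x [^] (p * (n div p)) = (x [^] p) [^] (n div p)"
    using assms(1) by (simp only: nat_pow_pow)
  finally show ?thesis using assms by simp
qed

text \<open>If \<open>p\<close> did not divide \<open>i\<close>, raising the relation to the power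
  of an inverse of \<open>i\<close> modulo \<open>p\<close> would turn the exponent of
  \<open>x\<close> into 1, against \<open>xy\<close>. What is left is
  \<open>y [^] j = \<one>\<close>, and the same device turns it into \<open>y = \<one>\<close>
  unless \<open>p\<close> divides \<open>j\<close>. So only relations with first exponent 1 have to
  be excluded arithmetically.\<close>

lemma (in comm_monoid) independent_powers:
  assumes x: "x \<in> carrier G" "x [^] (p::nat) = \<one>" and y: "y \<in> carrier G" "y [^] p = \<one>"
    and p: "Factorial_Ring.prime p"
    and xy: "\<And>k. k < p \<Longrightarrow> x \<otimes> y [^] k \<noteq> \<one>" and y1: "y \<noteq> \<one>"
    and eq: "x [^] (i::nat) \<otimes> y [^] (j::nat) = \<one>"
  shows "p dvd i \<and> p dvd j"
proof -
  have inverse: "\<exists>m. (n * m) mod p = 1" if "\<not> p dvd n" for n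
  proof -
    have "coprime n p"
      using that p prime_imp_coprime coprime_commute by blast
    moreover have "n \<noteq> 0" using that by (intro notI) simp
    ultimately obtain m k where "n * m = p * k + 1"
      using bezout_nat[of n p] by auto
    with prime_gt_1_nat[OF p] show ?thesis by (intro exI[of _ m]) (simp add: mod_Suc)
  qed
  have i: "p dvd i"
  proof (rule ccontr)
    assume "\<not> p dvd i"
    then obtain m where m: "(i * m) mod p = 1" using inverse by blast
    have "\<one> = (x [^] i \<otimes> y [^] j) [^] m" by (simp add: eq)
    also have "\<dots> = x [^] (i * m) \<otimes> y [^] (j * m)"
      using x y by (simp add: nat_pow_distrib nat_pow_pow)
    also have "\<dots> = x [^] (i * m mod p) \<otimes> y [^] (j * m mod p)"
      using x y by (simp add: nat_pow_mod)
    also have "\<dots> = x \<otimes> y [^] (j * m mod p)" using m x by simp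
    finally show False using xy[of "j * m mod p"] prime_gt_0_nat[OF p] by simp
  qed
  then have "x [^] i = \<one>"
    using nat_pow_mod[OF x, of i] by simp
  with eq y have yj: "y [^] j = \<one>" by simp
  have "p dvd j"
  proof (rule ccontr)
    assume "\<not> p dvd j"
    then obtain m where m: "(j * m) mod p = 1" using inverse by blast
    have "\<one> = (y [^] j) [^] m" by (simp add: yj)
    also have "\<dots> = y [^] (j * m mod p)" using y by (simp add: nat_pow_mod nat_pow_pow)
    also have "\<dots> = y" using m y by simp
    finally show False using y1 by simp
  qed
  with i show ?thesis by simp
qed

text \<open>The subgroup is the image of \<open>(i, j)\<close> under
  \<open>x [^] i \<otimes> y [^] j\<close>. Inverses are the complementary powers with exponents
  \<open>p - i\<close> and \<open>p - j\<close>, so a commutative monoid suffices as ambient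
  structure; this is the form in which \<open>ideal_class_group\<close> is available.\<close>

lemma (in comm_monoid) ex_subgroup_iso_integer_mod_group_squared:
  assumes p: "p > (0::nat)"
    and x: "x \<in> carrier G" "x [^] (p::nat) = \<one>" and y: "y \<in> carrier G" "y [^] p = \<one>"
    and indep: "\<And>i j::nat. x [^] i \<otimes> y [^] j = \<one> \<Longrightarrow> p dvd i \<and> p dvd j"
  shows "\<exists>H. subgroup H G \<and> G\<lparr>carrier := H\<rparr> \<cong> integer_mod_group p \<times>\<times> integer_mod_group p"
proof -
  define Z where "Z = integer_mod_group p \<times>\<times> integer_mod_group p"
  define \<phi> where "\<phi> = (\<lambda>(i::int, j::int). x [^] nat i \<otimes> y [^] nat j)"
  define H where "H = \<phi> ` carrier Z"
  have carZ: "carrier Z = {0..<int p} \<times> {0..<int p}"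
    using p by (simp add: Z_def carrier_integer_mod_group)
  have Zgrp: "group Z"
    unfolding Z_def by (intro DirProd_group) simp_all
  have powH: "x [^] (m::nat) \<otimes> y [^] (n::nat) \<in> H" for m n
  proof -
    have "\<phi> (int (m mod p), int (n mod p)) = x [^] m \<otimes> y [^] n"
      using x y by (simp add: \<phi>_def nat_pow_mod)
    moreover have "(int (m mod p), int (n mod p)) \<in> carrier Z"
      using p by (simp add: carZ)
    ultimately show ?thesis unfolding H_def by (metis imageI)
  qed
  have mult: "(x [^] (m::nat) \<otimes> y [^] (n::nat)) \<otimes> (x [^] (m'::nat) \<otimes> y [^] (n'::nat))
      = x [^] (m + m') \<otimes> y [^] (n + n')" for m n m' n'
    using x y by (simp add: nat_pow_mult[symmetric] m_ac)
  have HE: "\<exists>i j::nat. i < p \<and> j < p \<and> h = x [^] i \<otimes> y [^] j" if "h \<in> H" for h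
  proof -
    from that obtain i j where "(i, j) \<in> carrier Z" "h = \<phi> (i, j)"
      unfolding H_def by auto
    then show ?thesis
      by (intro exI[of _ "nat i"] exI[of _ "nat j"]) (auto simp: \<phi>_def carZ)
  qed
  have inverse: "(x [^] i \<otimes> y [^] j) \<otimes> (x [^] (p - i) \<otimes> y [^] (p - j)) = \<one>"
    if "i \<le> p" "j \<le> p" for i j
    using that x y by (simp add: mult)
  have sub: "subgroup H G"
  proof
    show "H \<subseteq> carrier G" using HE x y by blast
  next
    fix h h' assume "h \<in> H" "h' \<in> H"
    then show "h \<otimes> h' \<in> H"
      using HE mult powH by metis
  next
    show "\<one> \<in> H" using powH[of 0 0] by simp
  next
    fix h assume "h \<in> H"
    then obtain i j where ij: "i < p" "j < p" and h: "h = x [^] i \<otimes> y [^] j" using HE by blast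
    define h' where "h' = x [^] (p - i) \<otimes> y [^] (p - j)"
    have h': "h \<otimes> h' = \<one>" using inverse[of i j] ij by (simp add: h h'_def)
    have "inv h = h'"
      using h' x y by (intro comm_inv_char) (simp_all add: h h'_def)
    then show "inv h \<in> H" using powH by (simp add: h'_def)
  qed
  have inj: "inj_on \<phi> (carrier Z)"
  proof (rule inj_onI)
    fix u v assume uv: "u \<in> carrier Z" "v \<in> carrier Z" and eq: "\<phi> u = \<phi> v"
    obtain i j k l where ij: "u = (int i, int j)" "v = (int k, int l)"
      and b: "i < p" "j < p" "k < p" "l < p"
    proof -
      obtain i j k l where e: "u = (i, j)" "v = (k, l)" by fastforce
      show thesis
        using that[of "nat i" "nat j" "nat k" "nat l"] uv by (auto simp: e carZ)
    qed
    \<comment> \<open>Multiplying by complementary powers replaces the missing cancellation law: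
      equal images give a relation to which \<open>indep\<close> applies.\<close>
    have "x [^] (i + (p - k)) \<otimes> y [^] (j + (p - l))
        = (x [^] i \<otimes> y [^] j) \<otimes> (x [^] (p - k) \<otimes> y [^] (p - l))"
      by (simp add: mult)
    also have "\<dots> = (x [^] k \<otimes> y [^] l) \<otimes> (x [^] (p - k) \<otimes> y [^] (p - l))"
      using eq by (simp add: ij \<phi>_def)
    also have "\<dots> = \<one>" using inverse b by simp
    finally have dvd: "p dvd i + (p - k)" "p dvd j + (p - l)" using indep by blast+
    \<comment> \<open>The number \<open>m + (p - n)\<close> lies strictly between 0 and
      \<open>2 * p\<close>, so as a multiple of \<open>p\<close> it is \<open>p\<close>
      itself.\<close>
    have same: "m = n" if d: "p dvd m + (p - n)" and mn: "m < p" "n < p" for m n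
    proof -
      from d obtain c where c: "m + (p - n) = p * c" by (elim dvdE)
      have "0 < p * c" "p * c < p * 2" using c mn by linarith+
      then have "c = 1" using p by auto
      with c mn show ?thesis by simp
    qed
    show "u = v" using same dvd b by (simp add: ij)
  qed
  have "\<phi> \<in> hom Z (G\<lparr>carrier := H\<rparr>)"
  proof (rule homI)
    fix u assume "u \<in> carrier Z"
    then show "\<phi> u \<in> carrier (G\<lparr>carrier := H\<rparr>)" by (simp add: H_def)
  next
    fix u v assume uv: "u \<in> carrier Z" "v \<in> carrier Z"
    obtain i j k l where ij: "u = (int i, int j)" "v = (int k, int l)"
    proof -
      obtain i j k l where e: "u = (i, j)" "v = (k, l)" by fastforce
      show thesis
        using that[of "nat i" "nat j" "nat k" "nat l"] uv by (auto simp: e carZ)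
    qed
    have "u \<otimes>\<^bsub>Z\<^esub> v = (int ((i + k) mod p), int ((j + l) mod p))"
      by (simp add: Z_def ij zmod_int)
    then show "\<phi> (u \<otimes>\<^bsub>Z\<^esub> v) = \<phi> u \<otimes>\<^bsub>G\<lparr>carrier := H\<rparr>\<^esub> \<phi> v"
      using x y by (simp add: \<phi>_def nat_pow_mod ij mult)
  qed
  then have "\<phi> \<in> iso Z (G\<lparr>carrier := H\<rparr>)"
    using inj by (auto simp: iso_def bij_betw_def H_def)
  then have "Z \<cong> G\<lparr>carrier := H\<rparr>" by (auto simp: is_iso_def)
  then have "G\<lparr>carrier := H\<rparr> \<cong> Z" using group.iso_sym[OF Zgrp] by blast
  with sub show ?thesis unfolding Z_def by blast
qed

subsection \<open>Powers of ideals and of their classes\<close>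

context "domain"
begin

abbreviation ideal_class :: "'a set \<Rightarrow> 'a set set" where
  "ideal_class I \<equiv> ideal_class_rel R `` {I}"

lemma ideal_class_closed:
  "I \<in> nonzero_ideals R \<Longrightarrow> ideal_class I \<in> carrier (ideal_class_group R)"
  by (auto simp: ideal_class_group_def quotient_def)

lemma ideal_class_one: "\<one>\<^bsub>ideal_class_group R\<^esub> = ideal_class (carrier R)"
  by (simp add: ideal_class_group_def)

lemma ideal_pow_nonzero:
  assumes "I \<in> nonzero_ideals R"
  shows "I [^]\<^bsub>ideals_set R\<^esub> (n::nat) \<in> nonzero_ideals R"
proof (induction n)
  case 0
  then show ?case by (simp add: ideals_set_def carrier_nonzero_ideal)
next
  case (Suc n)
  then show ?case using ideal_prod_nonzero[OF Suc assms] by (simp add: ideals_set_def)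
qed

lemma ideal_class_pow:
  assumes "I \<in> nonzero_ideals R"
  shows "ideal_class I [^]\<^bsub>ideal_class_group R\<^esub> (n::nat)
       = ideal_class (I [^]\<^bsub>ideals_set R\<^esub> n)"
proof (induction n)
  case 0
  then show ?case by (simp add: ideals_set_def ideal_class_one)
next
  case (Suc n)
  have "monoid.mult (ideals_set R) = ideal_prod R" by (simp add: ideals_set_def)
  with Suc show ?case by (simp add: class_mult assms ideal_pow_nonzero)
qed

lemma PIdl_pow:
  assumes "a \<in> carrier R"
  shows "(PIdl a) [^]\<^bsub>ideals_set R\<^esub> (n::nat) = PIdl (a [^] n)"
proof (induction n)
  case 0
  have "PIdl \<one> = carrier R"
    by (auto simp: cgenideal_def) (metis r_one)
  then show ?case by (simp add: ideals_set_def)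
next
  case (Suc n)
  have "monoid.mult (ideals_set R) = ideal_prod R" by (simp add: ideals_set_def)
  with Suc show ?case using assms by (simp add: PIdl_prod)
qed

lemma PIdl_eqD:
  assumes "a \<in> carrier R" "b \<in> carrier R" "PIdl a = PIdl b"
  shows "\<exists>w\<in>carrier R. a = w \<otimes> b"
  using cgenideal_self[OF assms(1)] assms(3) by (auto simp: cgenideal_def)

text \<open>The multiples of \<open>a\<close> by elements of \<open>I\<close> are already closed
  under addition, so the sums in the inductive definition of \<open>ideal_prod\<close> contribute
  nothing new.\<close>

lemma PIdl_prod_iff:
  assumes a: "a \<in> carrier R" and I: "ideal I R"
  shows "z \<in> (PIdl a) \<cdot> I \<longleftrightarrow> (\<exists>x\<in>I. z = a \<otimes> x)"
proof
  assume "z \<in> (PIdl a) \<cdot> I"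
  then show "\<exists>x\<in>I. z = a \<otimes> x"
  proof (induction rule: ideal_prod.induct)
    case (prod i j)
    then obtain w where w: "w \<in> carrier R" "i = w \<otimes> a" by (auto simp: cgenideal_def)
    have j: "j \<in> carrier R" "w \<otimes> j \<in> I"
      using prod w I by (auto intro: ideal.Icarr ideal.I_l_closed)
    have "i \<otimes> j = a \<otimes> (w \<otimes> j)" using w j a by (simp add: m_ac)
    with j show ?case by blast
  next
    case (sum s1 s2)
    then obtain x y where xy: "x \<in> I" "y \<in> I" "s1 = a \<otimes> x" "s2 = a \<otimes> y" by blast
    then have "s1 \<oplus> s2 = a \<otimes> (x \<oplus> y)"
      using a ideal.Icarr[OF I] by (simp add: r_distr)
    moreover have "x \<oplus> y \<in> I"
      using xy I by (simp add: additive_subgroup.a_closed ideal.axioms(1))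
    ultimately show ?case by blast
  qed
next
  assume "\<exists>x\<in>I. z = a \<otimes> x"
  then show "z \<in> (PIdl a) \<cdot> I"
    using ideal_prod.prod[of a "PIdl a" _ I R] cgenideal_self[OF a] by blast
qed

text \<open>From \<open>aK = bR\<close> one gets \<open>b = a \<otimes> c\<close> with
  \<open>c\<close> in \<open>K\<close>; cancelling \<open>a\<close> shows that \<open>c\<close>
  generates \<open>K\<close>. This turns relations between classes into statements about
  generators.\<close>

lemma ideal_class_eq_one_iff:
  assumes K: "K \<in> nonzero_ideals R"
  shows "ideal_class K = \<one>\<^bsub>ideal_class_group R\<^esub> \<longleftrightarrow> (\<exists>c\<in>carrier R - {\<zero>}. K = PIdl c)"
proof
  assume "ideal_class K = \<one>\<^bsub>ideal_class_group R\<^esub>"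
  then have "(K, carrier R) \<in> ideal_class_rel R"
    using eq_equiv_class[OF _ equiv_ideal_class_rel carrier_nonzero_ideal]
    by (simp add: ideal_class_one)
  then obtain a b where ab: "a \<in> carrier R - {\<zero>}" "b \<in> carrier R - {\<zero>}"
    and eq: "(PIdl a) \<cdot> K = (PIdl b) \<cdot> carrier R" and iK: "ideal K R"
    by (elim ideal_class_relE)
  have a: "a \<in> carrier R" "a \<noteq> \<zero>" and b: "b \<in> carrier R" "b \<noteq> \<zero>" using ab by auto
  have "b \<in> (PIdl b) \<cdot> carrier R"
    using b by (subst PIdl_prod_iff) (auto intro!: bexI[of _ \<one>] oneideal)
  then obtain c where c: "c \<in> K" "b = a \<otimes> c"
    using PIdl_prod_iff[OF a(1) iK] eq by blast
  have c': "c \<in> carrier R" using c iK ideal.Icarr by metis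
  have "c \<noteq> \<zero>" using c a b by auto
  have "z \<in> PIdl c" if "z \<in> K" for z
  proof -
    have z: "z \<in> carrier R" using that iK ideal.Icarr by metis
    have "a \<otimes> z \<in> (PIdl b) \<cdot> carrier R"
      using PIdl_prod_iff[OF a(1) iK] that eq by blast
    then obtain w where w: "w \<in> carrier R" "a \<otimes> z = b \<otimes> w"
      using PIdl_prod_iff[OF b(1) oneideal] by blast
    then have "a \<otimes> z = a \<otimes> (w \<otimes> c)" using c c' a by (simp add: m_ac)
    then have "z = w \<otimes> c" using a z w c' by (simp add: m_lcancel)
    then show ?thesis using w by (auto simp: cgenideal_def)
  qed
  moreover have "PIdl c \<subseteq> K"
    using c iK by (auto simp: cgenideal_def intro: ideal.I_l_closed)
  ultimately have "K = PIdl c" by blast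
  with c' \<open>c \<noteq> \<zero>\<close> show "\<exists>c\<in>carrier R - {\<zero>}. K = PIdl c" by blast
next
  assume "\<exists>c\<in>carrier R - {\<zero>}. K = PIdl c"
  then obtain c where c: "c \<in> carrier R - {\<zero>}" "K = PIdl c" by blast
  have "(PIdl \<one>) \<cdot> K = (PIdl c) \<cdot> carrier R"
    using c cgenideal_ideal[of \<one>] cgenideal_ideal[of c] PIdl_prod[of \<one> c]
    by (simp add: ideal_prod_one)
  then have "(K, carrier R) \<in> ideal_class_rel R"
    using c K carrier_nonzero_ideal by (intro ideal_class_relI[where a = \<one> and b = c]) auto
  then show "ideal_class K = \<one>\<^bsub>ideal_class_group R\<^esub>"
    using equiv_class_eq[OF equiv_ideal_class_rel] by (simp add: ideal_class_one)
qed

end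

subsection \<open>The ring of integers of an imaginary quadratic field\<close>

lemma poly_map_poly_of_int_arith:
  fixes z :: "'a :: comm_ring_1" and p q :: "int poly"
  shows "poly (map_poly of_int (p + q)) z = poly (map_poly of_int p) z + poly (map_poly of_int q) z"
    and "poly (map_poly of_int (smult c p)) z = of_int c * poly (map_poly of_int p) z"
    and "poly (map_poly of_int (p * q)) z = poly (map_poly of_int p) z * poly (map_poly of_int q) z"
proof -
  show add: "poly (map_poly of_int (p + q)) z
      = poly (map_poly of_int p) z + poly (map_poly of_int q) z" for p q :: "int poly"
    by (induction p q rule: poly_induct2) (simp_all add: map_poly_pCons algebra_simps)
  show smult: "poly (map_poly of_int (smult c p)) z = of_int c * poly (map_poly of_int p) z"
    for c and p :: "int poly"
    by (induction p) (simp_all add: map_poly_pCons algebra_simps)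
  show "poly (map_poly of_int (p * q)) z = poly (map_poly of_int p) z * poly (map_poly of_int q) z"
    by (induction p) (simp_all add: map_poly_pCons add smult algebra_simps)
qed

text \<open>By Gauss's lemma, the primitive integral quadratic polynomial with root \<open>z\<close> divides the
  monic integral polynomial of \<open>z\<close> over the integers, so its leading coefficient is a unit.\<close>

lemma algebraic_int_quadratic_coeffs:
  fixes z :: complex
  assumes z: "algebraic_int z" and im: "Im z \<noteq> 0"
    and rat: "Re z \<in> \<rat>" "(cmod z)\<^sup>2 \<in> \<rat>"
  shows "2 * Re z \<in> \<int>" "(cmod z)\<^sup>2 \<in> \<int>"
proof -
  let ?ev = "\<lambda>p. poly (map_poly of_int p) z"
  note ev = poly_map_poly_of_int_arith
  obtain P where P: "?ev P = 0" "lead_coeff P = 1"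
    using z by (auto simp: algebraic_int_altdef_ipoly)
  \<comment> \<open>A nonreal \<open>z\<close> is no root of a nonzero integer polynomial of degree
    below 2: the imaginary part kills the linear coefficient, then the real part kills the constant
    one.\<close>
  have linear: "R = 0" if R: "?ev R = 0" "degree R < 2" for R :: "int poly"
  proof -
    have "R = [:coeff R 0, coeff R 1:]"
      using R(2) by (intro poly_eqI) (auto simp: coeff_pCons coeff_eq_0 split: nat.split)
    then obtain a b where R': "R = [:a, b:]" by blast
    have "of_int a + z * of_int b = 0" using R(1) by (simp add: R' map_poly_pCons)
    then have "Im (of_int a + z * of_int b) = 0" "Re (of_int a + z * of_int b) = 0" by simp_all
    then show ?thesis using im by (auto simp: R')
  qed
  obtain u d where u: "Re z = of_int u / of_int d" "d \<noteq> 0"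
    using rat(1) by (auto simp: Rats_eq_int_div_int)
  obtain v e where v: "(cmod z)\<^sup>2 = of_int v / of_int e" "e \<noteq> 0"
    using rat(2) by (auto simp: Rats_eq_int_div_int)
  \<comment> \<open>This is \<open>X^2 - 2 Re(z) X + |z|^2\<close> with the denominators cleared by
    the factor \<open>d * e\<close>.\<close>
  define Q0 where "Q0 = [:v * d, - 2 * u * e, d * e:]"
  have Q0: "Q0 \<noteq> 0" "degree Q0 = 2" using u v by (simp_all add: Q0_def)
  have evQ0: "?ev Q0 = 0"
  proof -
    have r: "of_int u = of_int d * Re z" "of_int v = of_int e * (cmod z)\<^sup>2"
      using u v by simp_all
    have "?ev Q0 = of_real (of_int v * of_int d)
        + z * (of_real (- 2 * of_int u * of_int e) + z * of_real (of_int d * of_int e))"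
      by (simp add: Q0_def map_poly_pCons)
    also have "\<dots> = 0"
      unfolding r cmod_power2 by (simp add: complex_eq_iff power2_eq_square algebra_simps)
    finally show ?thesis .
  qed
  define Q where "Q = primitive_part Q0"
  have Q0Q: "Q0 = smult (content Q0) Q" by (simp add: Q_def)
  have cQ: "content Q = 1" using Q0 by (simp add: Q_def)
  have dQ: "degree Q = 2" using Q0 by (simp add: Q_def)
  then have Qnz: "Q \<noteq> 0" by auto
  have evQ: "?ev Q = 0"
  proof -
    have "?ev Q0 = of_int (content Q0) * ?ev Q"
      by (subst Q0Q) (simp only: ev)
    with evQ0 Q0 show ?thesis by simp
  qed
  \<comment> \<open>Pseudo-division stays over the integers at the cost of the factor
    \<open>L\<close>, a power of the leading coefficient of \<open>Q\<close>. The remainder vanishes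
    at \<open>z\<close> and is therefore 0 by \<open>linear\<close>.\<close>
  obtain S R where SR: "pseudo_divmod P Q = (S, R)" by fastforce
  define L where "L = lead_coeff Q ^ (Suc (degree P) - degree Q)"
  have L: "L \<noteq> 0" using Qnz by (simp add: L_def)
  have div: "smult L P = Q * S + R" and dR: "R = 0 \<or> degree R < 2"
    using pseudo_divmod[OF Qnz SR] dQ by (simp_all add: L_def)
  have "?ev R = 0"
  proof -
    have "?ev (smult L P) = ?ev Q * ?ev S + ?ev R" by (simp only: div ev)
    with P evQ show ?thesis by (simp add: ev)
  qed
  with linear dR have "R = 0" by blast
  with div have div: "smult L P = Q * S" by simp
  \<comment> \<open>Gauss's lemma: \<open>P\<close> and \<open>Q\<close> have content 1, so
    \<open>S\<close> has content \<open>\<bar>L\<bar>\<close>. Dividing this out of the leading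
    coefficients in \<open>L P = Q S\<close> shows that the one of \<open>Q\<close> is a
    unit.\<close>
  have "content P dvd 1" using content_dvd_coeff[of P "degree P"] P by simp
  then have "content P = 1" by (simp only: is_unit_content_iff)
  then have "content S = \<bar>L\<bar>"
    using arg_cong[OF div, of content] by (simp add: content_mult cQ)
  then have "\<bar>L\<bar> dvd lead_coeff S" by (metis content_dvd_coeff)
  then obtain c where c: "lead_coeff S = \<bar>L\<bar> * c" by (elim dvdE)
  have "L = \<bar>L\<bar> * (lead_coeff Q * c)"
    using arg_cong[OF div, of lead_coeff] P L by (simp add: lead_coeff_mult c mult_ac)
  then have "\<bar>L\<bar> = \<bar>L\<bar> * \<bar>lead_coeff Q * c\<bar>" by (metis abs_abs abs_mult)
  then have "\<bar>lead_coeff Q * c\<bar> = 1" using L by simp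
  then have unit: "\<bar>lead_coeff Q\<bar> = 1"
    by (metis abs_mult abs_zmult_eq_1)
  define k where "k = content Q0"
  have "k \<noteq> 0" using Q0 by (simp add: k_def)
  define A B C where "A = coeff Q 2" and "B = coeff Q 1" and "C = coeff Q 0"
  have co: "coeff Q0 i = k * coeff Q i" for i by (subst Q0Q) (simp add: k_def)
  have "d * e = k * A" "- 2 * u * e = k * B" "v * d = k * C"
    using co[of 0] co[of 1] co[of 2] by (simp_all add: Q0_def A_def B_def C_def numeral_2_eq_2)
  \<comment> \<open>Since \<open>A\<close> is 1 or -1, \<open>d * e = k * A\<close> can be solved
    for \<open>k\<close>, after which the denominators cancel.\<close>
  moreover have A: "A * A = 1" using unit dQ by (auto simp: A_def abs_if split: if_splits)
  ultimately have de: "d * e * A = k" "- 2 * u * e = d * e * A * B" "v * d = d * e * A * C"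
    by (simp_all add: mult.assoc)
  have "2 * Re z = - of_int (A * B)"
  proof -
    have "e * (- 2 * u) = e * (d * A * B)" using de by (simp add: mult_ac)
    then have "- 2 * u = d * A * B" using v(2) by (simp only: mult_cancel_left) simp
    then have "2 * u = - (d * A * B)" by linarith
    also have "\<dots> = - (A * B) * d" by simp
    finally have "2 * u = - (A * B) * d" .
    then have "real_of_int (2 * u) = real_of_int (- (A * B) * d)" by (simp only:)
    then show ?thesis unfolding u(1) using u(2) by (simp add: field_simps)
  qed
  moreover have "(cmod z)\<^sup>2 = of_int (A * C)"
  proof -
    have "real_of_int (v * d) = real_of_int (d * e * A * C)" using de by (simp only:)
    then show ?thesis using u v by (simp add: field_simps)
  qed
  ultimately show "2 * Re z \<in> \<int>" "(cmod z)\<^sup>2 \<in> \<int>"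
    by (metis Ints_of_int Ints_minus)+
qed

section \<open>Coordinates in Q(sqrt(-f)), and its ring of integers Z[(1 + sqrt(-f)) / 2] for
  square-free f = 3 modulo 4\<close>

definition quadratic_ints :: "int \<Rightarrow> complex set" where
  "quadratic_ints f =
     {Complex (of_int m / 2) (of_int t * sqrt (of_int f) / 2) | m t. even (m - t)}"

lemma csqrt_neg_of_int:
  assumes "f > 0"
  shows "csqrt (of_int (- f)) = Complex 0 (sqrt (of_int f))"
  using assms by (simp add: complex_eq_iff csqrt_of_real_nonpos)

lemma ring_of_type_algebra_simps [simp]:
  "carrier (ring_of_type_algebra :: 'a :: comm_ring_1 ring) = UNIV"
  "\<zero>\<^bsub>ring_of_type_algebra :: 'a ring\<^esub> = 0"
  "\<one>\<^bsub>ring_of_type_algebra :: 'a ring\<^esub> = 1"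
  "add (ring_of_type_algebra :: 'a ring) = (+)"
  "monoid.mult (ring_of_type_algebra :: 'a ring) = (*)"
  by (simp_all add: ring_of_type_algebra_def)

lemma ring_of_type_algebra_uminus:
  "\<ominus>\<^bsub>ring_of_type_algebra :: 'a :: comm_ring_1 ring\<^esub> x = - x"
proof -
  interpret cring "ring_of_type_algebra :: 'a ring" by (rule cring_from_type_algebra)
  show ?thesis
    using minus_equality[of "- x" x] by simp
qed

lemma ring_of_type_algebra_inverse:
  assumes "x \<noteq> (0 :: 'a :: field)"
  shows "inv\<^bsub>ring_of_type_algebra\<^esub> x = inverse x"
proof -
  interpret field "ring_of_type_algebra :: 'a ring" by (rule field_from_type_algebra)
  show ?thesis
    using comm_inv_char[of x "inverse x"] assms by simp
qed

lemma quadratic_field_eq: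
  assumes f: "f > 0"
  shows "quadratic_field (- f) = {Complex r (s * sqrt (of_int f)) | r s. r \<in> \<rat> \<and> s \<in> \<rat>}"
    (is "_ = ?K")
proof
  show "quadratic_field (- f) \<subseteq> ?K"
  proof
    fix z assume "z \<in> quadratic_field (- f)"
    then show "z \<in> ?K"
      unfolding quadratic_field_def
    proof (induction rule: generate_field.induct)
      case one
      show ?case by (auto simp: complex_eq_iff intro!: exI[of _ 1] exI[of _ 0])
    next
      case (incl h)
      then show ?case using f csqrt_neg_of_int[OF f]
        by (auto simp: complex_eq_iff intro!: exI[of _ 1] exI[of _ 0])
    next
      case (a_inv h)
      then obtain r s where "r \<in> \<rat>" "s \<in> \<rat>" "h = Complex r (s * sqrt (of_int f))" by blast
      then show ?case
        by (auto simp: ring_of_type_algebra_uminus complex_eq_iff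
              intro!: exI[of _ "- r"] exI[of _ "- s"])
    next
      case (m_inv h)
      then obtain r s where h: "r \<in> \<rat>" "s \<in> \<rat>" "h = Complex r (s * sqrt (of_int f))" by blast
      \<comment> \<open>The norm of \<open>h\<close>; the inverse is the conjugate divided by
        it.\<close>
      define n where "n = r\<^sup>2 + s\<^sup>2 * of_int f"
      have "n \<in> \<rat>" using h by (auto simp: n_def)
      moreover have "inverse h = Complex (r / n) (- s / n * sqrt (of_int f))"
        using f by (simp add: h n_def complex_eq_iff power_mult_distrib)
      ultimately show ?case using h m_inv
        by (auto simp: ring_of_type_algebra_inverse simp del: inverse_complex.simps
            intro!: exI[of _ "r / n"] exI[of _ "- s / n"])
    next
      case (eng_add h1 h2)
      then obtain r s r' s' where "r \<in> \<rat>" "s \<in> \<rat>" "h1 = Complex r (s * sqrt (of_int f))"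
        "r' \<in> \<rat>" "s' \<in> \<rat>" "h2 = Complex r' (s' * sqrt (of_int f))" by blast
      then show ?case
        by (auto simp: complex_eq_iff algebra_simps intro!: exI[of _ "r + r'"] exI[of _ "s + s'"])
    next
      case (eng_mult h1 h2)
      then obtain r s r' s' where "r \<in> \<rat>" "s \<in> \<rat>" "h1 = Complex r (s * sqrt (of_int f))"
        "r' \<in> \<rat>" "s' \<in> \<rat>" "h2 = Complex r' (s' * sqrt (of_int f))" by blast
      then show ?case using f
        by (auto simp: complex_eq_iff algebra_simps
            intro!: exI[of _ "r * r' - s * s' * of_int f"] exI[of _ "r * s' + s * r'"])
    qed
  qed
next
  interpret field "ring_of_type_algebra :: complex ring" by (rule field_from_type_algebra)
  let ?F = "quadratic_field (- f)"
  have add: "x + y \<in> ?F" if "x \<in> ?F" "y \<in> ?F" for x y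
    using generate_field.eng_add[of x ring_of_type_algebra _ y] that
    by (simp add: quadratic_field_def)
  have mult: "x * y \<in> ?F" if "x \<in> ?F" "y \<in> ?F" for x y
    using generate_field.eng_mult[of x ring_of_type_algebra _ y] that
    by (simp add: quadratic_field_def)
  have uminus: "- x \<in> ?F" if "x \<in> ?F" for x
    using generate_field.a_inv[of x ring_of_type_algebra] that
    by (simp add: quadratic_field_def ring_of_type_algebra_uminus)
  have inverse: "inverse x \<in> ?F" if "x \<in> ?F" for x
    using generate_field.m_inv[of x ring_of_type_algebra] that
    by (cases "x = 0") (simp_all add: quadratic_field_def ring_of_type_algebra_inverse)
  have one: "1 \<in> ?F"
    unfolding quadratic_field_def
    by (metis generate_field.one ring_of_type_algebra_simps(3))
  have zero: "0 \<in> ?F" using add[OF one uminus[OF one]] by simp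
  have gen: "Complex 0 (sqrt (of_int f)) \<in> ?F"
    unfolding quadratic_field_def csqrt_neg_of_int[OF f]
    by (rule generate_field.incl) simp
  have nat: "of_nat n \<in> ?F" for n by (induction n) (auto intro: zero one add)
  have int: "of_int n \<in> ?F" for n by (cases n) (auto intro: nat uminus simp del: of_nat_Suc)
  have rat: "of_real r \<in> ?F" if r: "r \<in> \<rat>" for r
  proof -
    obtain a b where "r = of_int a / of_int b"
      using r unfolding Rats_eq_int_div_int by blast
    then have "of_real r = of_int a * inverse (of_int b :: complex)" by (simp add: field_simps)
    then show ?thesis using mult[OF int inverse[OF int]] by simp
  qed
  show "?K \<subseteq> ?F"
  proof safe
    fix r s :: real assume "r \<in> \<rat>" "s \<in> \<rat>"
    then have "of_real r + of_real s * Complex 0 (sqrt (of_int f)) \<in> ?F"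
      by (intro add mult rat gen)
    moreover have "of_real r + of_real s * Complex 0 (sqrt (of_int f))
        = Complex r (s * sqrt (of_int f))"
      by (simp add: complex_eq_iff)
    ultimately show "Complex r (s * sqrt (of_int f)) \<in> ?F" by simp
  qed
qed

text \<open>With \<open>s = c / d\<close> in lowest terms, \<open>d^2\<close> divides
  \<open>f * c^2\<close>, hence \<open>f\<close>, and square-freeness leaves
  \<open>d = 1\<close>.\<close>

lemma Ints_of_squarefree_mult_square:
  assumes f: "squarefree (f :: int)" and s: "s \<in> \<rat>" and int: "of_int f * s\<^sup>2 \<in> (\<int> :: real set)"
  shows "s \<in> \<int>"
proof -
  obtain c d where cd: "s = of_int c / of_int d" "d > 0" "coprime c d"
    using s by (elim Rats_cases') simp
  from int obtain e where "of_int f * s\<^sup>2 = of_int e" by (auto elim: Ints_cases)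
  then have "real_of_int (f * c\<^sup>2) = real_of_int (e * d\<^sup>2)"
    using cd by (simp add: power_divide field_simps)
  then have "f * c\<^sup>2 = e * d\<^sup>2" by (simp only: of_int_eq_iff)
  then have "d\<^sup>2 dvd f * c\<^sup>2" by simp
  moreover have "coprime (d\<^sup>2) (c\<^sup>2)" using cd by (simp add: coprime_commute)
  ultimately have "d\<^sup>2 dvd f" by (simp add: coprime_dvd_mult_left_iff)
  then have "d dvd 1" using f squarefreeD by blast
  then have "d = 1" using cd by simp
  with cd show ?thesis by simp
qed

lemma norm_quadratic_int:
  assumes "f > 0"
  shows "4 * (cmod (Complex (of_int m / 2) (of_int t * sqrt (of_int f) / 2)))\<^sup>2
       = of_int (m\<^sup>2 + f * t\<^sup>2)"
  using assms by (simp add: cmod_power2 power_divide power_mult_distrib)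

text \<open>Modulo 4 the form is \<open>m^2 - t^2\<close>, which vanishes exactly when
  \<open>m\<close> and \<open>t\<close> have the same parity.\<close>

lemma even_diff_iff_4_dvd:
  assumes "(f :: int) mod 4 = 3"
  shows "even (m - t) \<longleftrightarrow> 4 dvd m\<^sup>2 + f * t\<^sup>2"
proof -
  define c where "c = f div 4"
  have f: "f = 4 * c + 3" using assms mult_div_mod_eq[of 4 f] by (simp add: c_def)
  show ?thesis
  proof (cases "even m"; cases "even t")
    assume "even m" "even t"
    then obtain i j where "m = 2 * i" "t = 2 * j" by (elim evenE)
    then show ?thesis by (simp add: power2_eq_square)
  next
    assume "odd m" "odd t"
    then obtain i j where mt: "m = 2 * i + 1" "t = 2 * j + 1" by (elim oddE)
    have "m\<^sup>2 + f * t\<^sup>2 = 4 * (i\<^sup>2 + i + c * t\<^sup>2 + 3 * (j\<^sup>2 + j) + 1)"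
      by (simp add: mt f power2_eq_square algebra_simps)
    with mt show ?thesis by simp
  next
    assume "odd m" "even t"
    moreover from this have "odd (m\<^sup>2 + f * t\<^sup>2)" by simp
    ultimately show ?thesis using dvd_trans[of 2 4 "m\<^sup>2 + f * t\<^sup>2"] by auto
  next
    assume "even m" "odd t"
    moreover from this have "odd (m\<^sup>2 + f * t\<^sup>2)" by (simp add: f)
    ultimately show ?thesis using dvd_trans[of 2 4 "m\<^sup>2 + f * t\<^sup>2"] by auto
  qed
qed

text \<open>For an algebraic integer \<open>r + s sqrt(-f)\<close> off the real axis, the trace
  \<open>2 * r\<close> and the norm are integers. Then \<open>f * (2 * s)^2\<close> is an integer,
  square-freeness makes \<open>2 * s\<close> one, and integrality of the norm gives the parity
  condition. Conversely, each element of \<open>quadratic_ints f\<close> is a root of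
  \<open>X^2 - m X + n\<close>, where \<open>n\<close> is its norm.\<close>

lemma carrier_ring_of_integers:
  assumes f: "f > 0" "squarefree f" "f mod 4 = 3"
  shows "carrier (ring_of_integers (quadratic_field (- f))) = quadratic_ints f"
proof -
  have "z \<in> quadratic_ints f" if z: "z \<in> quadratic_field (- f)" "algebraic_int z" for z
  proof -
    obtain r s where rs: "r \<in> \<rat>" "s \<in> \<rat>" and zrs: "z = Complex r (s * sqrt (of_int f))"
      using z(1) by (auto simp: quadratic_field_eq[OF f(1)])
    have norm: "(cmod z)\<^sup>2 = r\<^sup>2 + of_int f * s\<^sup>2"
      using f by (simp add: zrs cmod_power2 power_mult_distrib)
    show ?thesis
    \<comment> \<open>The real case is treated apart, because
      \<open>algebraic_int_quadratic_coeffs\<close> assumes a nonzero imaginary part.\<close>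
    proof (cases "s = 0")
      case True
      then have "z = of_real r" by (simp add: zrs complex_eq_iff)
      with z(2) have "algebraic_int r" by simp
      with rs have "r \<in> \<int>" by (simp add: rational_algebraic_int_is_int)
      then obtain n where "r = of_int n" by (elim Ints_cases)
      with True show ?thesis
        unfolding quadratic_ints_def zrs
        by (intro CollectI exI[of _ "2 * n"] exI[of _ 0]) simp
    next
      case False
      have "2 * Re z \<in> \<int>" "(cmod z)\<^sup>2 \<in> \<int>"
        using algebraic_int_quadratic_coeffs[OF z(2)] False f rs norm by (simp_all add: zrs)
      then obtain m n where mn: "2 * r = of_int m" "r\<^sup>2 + of_int f * s\<^sup>2 = of_int n"
        by (auto simp: zrs norm[unfolded zrs] elim!: Ints_cases)
      have "of_int f * (2 * s)\<^sup>2 = 4 * (r\<^sup>2 + of_int f * s\<^sup>2) - (2 * r)\<^sup>2"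
        by (simp add: power_mult_distrib algebra_simps)
      also have "\<dots> = of_int (4 * n - m\<^sup>2)" by (simp add: mn)
      finally have eq: "of_int f * (2 * s)\<^sup>2 = real_of_int (4 * n - m\<^sup>2)" .
      moreover have "2 * s \<in> \<rat>" using rs by simp
      ultimately have "2 * s \<in> \<int>"
        using Ints_of_squarefree_mult_square[OF f(2)] by (metis Ints_of_int)
      then obtain t where t: "2 * s = of_int t" by (elim Ints_cases)
      have "real_of_int (m\<^sup>2 + f * t\<^sup>2) = real_of_int (4 * n)"
        using eq by (simp add: t)
      then have "m\<^sup>2 + f * t\<^sup>2 = 4 * n" by (simp only: of_int_eq_iff)
      then have "even (m - t)" using even_diff_iff_4_dvd[OF f(3)] by simp
      moreover have "z = Complex (of_int m / 2) (of_int t * sqrt (of_int f) / 2)"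
        using mn t by (simp add: zrs complex_eq_iff)
      ultimately show ?thesis by (auto simp: quadratic_ints_def)
    qed
  qed
  moreover have "z \<in> quadratic_field (- f) \<and> algebraic_int z" if "z \<in> quadratic_ints f" for z
  proof -
    obtain m t where mt: "even (m - t)"
      and z: "z = Complex (of_int m / 2) (of_int t * sqrt (of_int f) / 2)"
      using \<open>z \<in> _\<close> by (auto simp: quadratic_ints_def)
    from mt obtain n where n: "m\<^sup>2 + f * t\<^sup>2 = 4 * n"
      using even_diff_iff_4_dvd[OF f(3)] by (auto elim: dvdE)
    have "z \<in> quadratic_field (- f)"
      unfolding quadratic_field_eq[OF f(1)] z
      by (intro CollectI exI[of _ "of_int m / 2"] exI[of _ "of_int t / 2"]) auto
    moreover have "algebraic_int z"
    proof (rule algebraic_int.intros)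
      have n': "of_int n = (of_int m)\<^sup>2 / 4 + of_int f * (of_int t)\<^sup>2 / (4::real)"
        using arg_cong[OF n, of real_of_int] by simp
      show "poly [:of_int n, - of_int m, 1:] z = 0"
        using f by (simp add: z complex_eq_iff n' power2_eq_square field_simps)
      show "\<forall>i. coeff [:of_int n, - of_int m, 1:] i \<in> (\<int> :: complex set)"
        by (auto simp: coeff_pCons split: nat.split)
    qed simp
    ultimately show ?thesis by blast
  qed
  ultimately show ?thesis
    unfolding ring_of_integers_def by auto
qed

subsection \<open>Ideals and classes generated by coprime roots of norms\<close>

locale imaginary_quadratic =
  fixes f :: int
  assumes f_pos: "f > 0" and f_squarefree: "squarefree f" and f_mod4: "f mod 4 = 3"
begin

abbreviation integers ("\<O>") where "\<O> \<equiv> quadratic_ints f"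

definition R where "R = ring_of_integers (quadratic_field (- f))"

lemma R_simps [simp]:
  "carrier R = \<O>" "\<zero>\<^bsub>R\<^esub> = 0" "\<one>\<^bsub>R\<^esub> = 1" "add R = (+)" "monoid.mult R = (*)"
  using carrier_ring_of_integers[OF f_pos f_squarefree f_mod4]
  by (simp_all add: R_def ring_of_integers_def)

lemma R_pow: "x [^]\<^bsub>R\<^esub> (n::nat) = x ^ n"
  by (induction n) simp_all

lemma integersE:
  assumes "z \<in> \<O>"
  obtains m t where "even (m - t)" "z = Complex (of_int m / 2) (of_int t * sqrt (of_int f) / 2)"
  using assms by (auto simp: quadratic_ints_def)

lemma integersI:
  assumes "even (m - t)" "z = Complex (of_int m / 2) (of_int t * sqrt (of_int f) / 2)"
  shows "z \<in> \<O>"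
  using assms by (auto simp: quadratic_ints_def)

lemma integers_add:
  assumes "x \<in> \<O>" "y \<in> \<O>"
  shows "x + y \<in> \<O>"
proof -
  obtain m t where x: "even (m - t)" "x = Complex (of_int m / 2) (of_int t * sqrt (of_int f) / 2)"
    using assms(1) by (rule integersE)
  obtain n s where y: "even (n - s)" "y = Complex (of_int n / 2) (of_int s * sqrt (of_int f) / 2)"
    using assms(2) by (rule integersE)
  have "even ((m + n) - (t + s))" using x(1) y(1) by simp
  moreover have "x + y
      = Complex (of_int (m + n) / 2) (of_int (t + s) * sqrt (of_int f) / 2)"
    by (simp add: x y complex_eq_iff field_simps)
  ultimately show ?thesis by (rule integersI)
qed

lemma integers_uminus:
  assumes "x \<in> \<O>"
  shows "- x \<in> \<O>"
proof -
  obtain m t where x: "even (m - t)" "x = Complex (of_int m / 2) (of_int t * sqrt (of_int f) / 2)"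
    using assms by (rule integersE)
  have "even (- m - (- t))" using x(1) by simp
  then show ?thesis by (rule integersI) (simp add: x(2) complex_eq_iff)
qed

lemma integers_mult:
  assumes "x \<in> \<O>" "y \<in> \<O>"
  shows "x * y \<in> \<O>"
proof -
  obtain m t where x: "even (m - t)" "x = Complex (of_int m / 2) (of_int t * sqrt (of_int f) / 2)"
    using assms(1) by (rule integersE)
  obtain n s where y: "even (n - s)" "y = Complex (of_int n / 2) (of_int s * sqrt (of_int f) / 2)"
    using assms(2) by (rule integersE)
  define c where "c = f div 4"
  have f: "f = 4 * c + 3" using f_mod4 mult_div_mod_eq[of 4 f] by (simp add: c_def)
  obtain i where "m - t = 2 * i" using x(1) by (rule evenE)
  then have m: "m = t + 2 * i" by simp
  obtain j where "n - s = 2 * j" using y(1) by (rule evenE)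
  then have n: "n = s + 2 * j" by simp
  \<comment> \<open>Division-free forms of \<open>(m * n - f * t * s) / 2\<close> and
    \<open>(m * s + n * t) / 2\<close>, the coordinates of the product, obtained by substituting for
    \<open>m\<close>, \<open>n\<close> and \<open>f\<close>.\<close>
  define k where "k = t * j + i * s + 2 * i * j - 2 * c * t * s - t * s"
  define l where "l = t * s + t * j + i * s"
  have k: "m * n - f * t * s = 2 * k" and l: "m * s + n * t = 2 * l"
    by (simp_all add: k_def l_def m n f algebra_simps)
  have "k - l = 2 * (i * j - c * t * s - t * s)"
    by (simp add: k_def l_def algebra_simps)
  then have "even (k - l)" by simp
  moreover have "x * y = Complex (of_int k / 2) (of_int l * sqrt (of_int f) / 2)"
  proof -
    have k': "of_int k = (of_int m * of_int n - of_int f * of_int t * of_int s) / (2 :: real)"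
      using arg_cong[OF k, of real_of_int] by simp
    have l': "of_int l = (of_int m * of_int s + of_int n * of_int t) / (2 :: real)"
      using arg_cong[OF l, of real_of_int] by simp
    show ?thesis using f_pos
      by (simp add: x y complex_eq_iff k' l' field_simps)
  qed
  ultimately show ?thesis by (rule integersI)
qed

lemma integers_of_int: "of_int n \<in> \<O>"
proof -
  have "of_int n = Complex (of_int (2 * n) / 2) (of_int 0 * sqrt (of_int f) / 2)"
    by (simp add: complex_eq_iff)
  then show ?thesis by (intro integersI[of "2 * n" 0]) simp_all
qed

lemma integers_one: "1 \<in> \<O>"
  using integers_of_int[of 1] by simp

lemma integers_zero: "0 \<in> \<O>"
  using integers_of_int[of 0] by simp

lemma integers_power: "x \<in> \<O> \<Longrightarrow> x ^ n \<in> \<O>"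
  by (induction n) (auto intro: integers_mult integers_one)

lemma integers_cnj:
  assumes "x \<in> \<O>"
  shows "cnj x \<in> \<O>"
proof -
  obtain m t where x: "even (m - t)" "x = Complex (of_int m / 2) (of_int t * sqrt (of_int f) / 2)"
    using assms by (rule integersE)
  have "even (m - (- t))" using x(1) by simp
  then show ?thesis by (rule integersI) (simp add: x(2) complex_eq_iff)
qed

lemmas integers_intros = integers_add integers_uminus integers_mult integers_of_int
  integers_one integers_zero integers_power integers_cnj

lemma norm_Ints:
  assumes "z \<in> \<O>"
  shows "(cmod z)\<^sup>2 \<in> \<int>"
proof -
  obtain m t where z: "even (m - t)" "z = Complex (of_int m / 2) (of_int t * sqrt (of_int f) / 2)"
    using assms by (rule integersE)
  obtain n where "m\<^sup>2 + f * t\<^sup>2 = 4 * n"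
    using z(1) even_diff_iff_4_dvd[OF f_mod4] by (auto elim: dvdE)
  then have "(cmod z)\<^sup>2 = of_int n"
    using norm_quadratic_int[OF f_pos, of m t] by (simp add: z)
  then show ?thesis by simp
qed

text \<open>The bound \<open>m^2 + f * t^2 <= f\<close> leaves \<open>t = 0\<close> or the
  borderline case \<open>m = 0\<close>, \<open>t^2 = 1\<close>, and the latter violates the parity
  condition. Hence a norm equal to \<open>f / 4\<close> is still admissible.\<close>

lemma real_if_norm_le:
  assumes "z \<in> \<O>" "4 * (cmod z)\<^sup>2 \<le> of_int f"
  shows "cnj z = z"
proof -
  obtain m t where z: "even (m - t)" "z = Complex (of_int m / 2) (of_int t * sqrt (of_int f) / 2)"
    using assms(1) by (rule integersE)
  have "real_of_int (m\<^sup>2 + f * t\<^sup>2) \<le> of_int f"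
    using assms(2) norm_quadratic_int[OF f_pos, of m t] by (simp only: z)
  then have le: "m\<^sup>2 + f * t\<^sup>2 \<le> f" by (simp only: of_int_le_iff)
  have "t = 0"
  proof (rule ccontr)
    assume "t \<noteq> 0"
    then have "1 \<le> t\<^sup>2" using zero_less_power2[of t] by linarith
    then have "f * 1 \<le> f * t\<^sup>2" using f_pos by (intro mult_left_mono) simp_all
    with le have "m\<^sup>2 \<le> 0" "f * t\<^sup>2 \<le> f * 1" using zero_le_power2[of m] by linarith+
    then have "m = 0" "t\<^sup>2 \<le> 1" using f_pos by simp_all
    with \<open>1 \<le> t\<^sup>2\<close> have "t\<^sup>2 = 1" by simp
    then have "odd t" by (auto simp: power2_eq_1_iff)
    with z(1) \<open>m = 0\<close> show False by simp
  qed
  then show ?thesis by (simp add: z complex_eq_iff)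
qed

lemma domain_R: "domain R"
proof -
  interpret C: field "ring_of_type_algebra :: complex ring" by (rule field_from_type_algebra)
  have "subring \<O> (ring_of_type_algebra :: complex ring)"
    by (rule C.subringI) (auto simp: ring_of_type_algebra_uminus intro: integers_intros)
  then have "subdomain \<O> (ring_of_type_algebra :: complex ring)"
    by (rule C.subdomainI')
  then have "domain ((ring_of_type_algebra :: complex ring)\<lparr>carrier := \<O>\<rparr>)"
    by (simp add: C.subdomain_iff)
  moreover have "(ring_of_type_algebra :: complex ring)\<lparr>carrier := \<O>\<rparr> = R"
    using R_simps(1) by (simp add: R_def ring_of_integers_def)
  ultimately show ?thesis by simp
qed

sublocale D: "domain" R
  by (rule domain_R)

section \<open>Ideals with two generators, their products and powers\<close>

lemma ideal_memI:
  assumes "ideal I R" "x \<in> I"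
  shows "w \<in> \<O> \<Longrightarrow> w * x \<in> I" "y \<in> I \<Longrightarrow> x + y \<in> I"
  using ideal.I_l_closed[OF assms, of w]
    additive_subgroup.a_closed[OF ideal.axioms(1)[OF assms(1)] assms(2), of y]
  by simp_all

definition ideal2 :: "complex \<Rightarrow> complex \<Rightarrow> complex set" where
  "ideal2 x y = (PIdl\<^bsub>R\<^esub> x) <+>\<^bsub>R\<^esub> (PIdl\<^bsub>R\<^esub> y)"

lemma mem_ideal2: "z \<in> ideal2 x y \<longleftrightarrow> (\<exists>u\<in>\<O>. \<exists>w\<in>\<O>. z = u * x + w * y)"
  by (auto simp: ideal2_def set_add_def' cgenideal_def)

lemma ideal_ideal2: "x \<in> \<O> \<Longrightarrow> y \<in> \<O> \<Longrightarrow> ideal (ideal2 x y) R"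
  unfolding ideal2_def by (intro D.add_ideals D.cgenideal_ideal) simp_all

lemma ideal2_generators: "x \<in> ideal2 x y" "y \<in> ideal2 x y"
  unfolding mem_ideal2
  by (rule bexI[of _ 1], rule bexI[of _ 0], simp, rule integers_zero, rule integers_one,
      rule bexI[of _ 0], rule bexI[of _ 1], simp, rule integers_one, rule integers_zero)

lemma ideal2_subset:
  assumes "ideal K R" "x \<in> K" "y \<in> K"
  shows "ideal2 x y \<subseteq> K"
  using assms by (auto simp: mem_ideal2 intro!: ideal_memI)

lemma ideal2_prod_subset:
  assumes K: "ideal K R" and "x * x' \<in> K" "x * y' \<in> K" "y * x' \<in> K" "y * y' \<in> K"
  shows "ideal2 x y \<cdot>\<^bsub>R\<^esub> ideal2 x' y' \<subseteq> K"
proof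
  fix z assume "z \<in> ideal2 x y \<cdot>\<^bsub>R\<^esub> ideal2 x' y'"
  then show "z \<in> K"
  proof (induction rule: ideal_prod.induct)
    case (prod i j)
    then obtain u w u' w' where uw: "u \<in> \<O>" "w \<in> \<O>" "u' \<in> \<O>" "w' \<in> \<O>"
      and ij: "i = u * x + w * y" "j = u' * x' + w' * y'"
      by (auto simp: mem_ideal2)
    have "i * j = (u * u') * (x * x') + ((u * w') * (x * y') + ((w * u') * (y * x') + (w * w') * (y * y')))"
      by (simp add: ij algebra_simps)
    also have "\<dots> \<in> K"
      by (rule assms(2-5) ideal_memI(2)[OF K] ideal_memI(1)[OF K] integers_mult[OF uw(1,3)]
          integers_mult[OF uw(1,4)] integers_mult[OF uw(2,3)] integers_mult[OF uw(2,4)])+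
    finally show ?case by simp
  next
    case (sum s1 s2)
    then show ?case using ideal_memI(2)[OF K] by simp
  qed
qed

text \<open>In the product \<open>(x^k, y) (x, y)\<close> the generator \<open>y\<close> survives
  because \<open>y = u y^2 + w (y y')\<close> and \<open>y y' = x^p\<close> is a multiple of
  \<open>x^(k+1)\<close> as long as \<open>k + 1 <= p\<close>. Later \<open>x\<close> is a rational
  integer and \<open>y'\<close> the conjugate of \<open>y\<close>.\<close>

lemma ideal2_pow:
  assumes x: "x \<in> \<O>" "y \<in> \<O>" "y' \<in> \<O>" and xy: "x ^ p = y * y'"
    and cop: "u \<in> \<O>" "w \<in> \<O>" "u * y + w * y' = 1" and k: "Suc k \<le> p"
  shows "ideal2 x y [^]\<^bsub>ideals_set R\<^esub> Suc k = ideal2 (x ^ Suc k) y"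
  using k
proof (induction k)
  case 0
  have "carrier R \<cdot>\<^bsub>R\<^esub> ideal2 x y = ideal2 x y"
    using D.ideal_prod_one[OF ideal_ideal2] x D.ideal_prod_commute[OF D.oneideal ideal_ideal2] by simp
  then show ?case by (simp add: ideals_set_def)
next
  case (Suc k)
  let ?J = "ideal2 (x ^ Suc k) y \<cdot>\<^bsub>R\<^esub> ideal2 x y"
  have J: "ideal ?J R" using x by (intro D.ideal_prod_is_ideal ideal_ideal2 integers_power)
  have gens: "(x ^ Suc k) * x \<in> ?J" "y * y \<in> ?J"
    using ideal_prod.prod[of "x ^ Suc k" "ideal2 (x ^ Suc k) y" x "ideal2 x y" R]
      ideal_prod.prod[of y "ideal2 (x ^ Suc k) y" y "ideal2 x y" R]
    by (simp_all add: ideal2_generators)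
  have "x ^ p = x ^ (p - Suc (Suc k)) * ((x ^ Suc k) * x)"
    using Suc.prems by (metis le_add_diff_inverse2 power_Suc2 power_add)
  then have "y * y' \<in> ?J"
    using xy ideal_memI(1)[OF J gens(1) integers_power[OF x(1)]] by simp
  moreover have "y = u * (y * y) + w * (y * y')"
    using arg_cong[OF cop(3), of "\<lambda>t. y * t"] by (simp add: algebra_simps)
  ultimately have yJ: "y \<in> ?J"
    using ideal_memI[OF J] gens(2) cop by metis
  have "?J = ideal2 (x ^ Suc (Suc k)) y"
  proof
    have K: "ideal (ideal2 (x ^ Suc (Suc k)) y) R" (is "ideal ?K R")
      using x by (intro ideal_ideal2 integers_power)
    have "z * y \<in> ?K" if "z \<in> \<O>" for z
      using ideal_memI(1)[OF K ideal2_generators(2) that] .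
    moreover have "x ^ Suc k * x \<in> ?K" using ideal2_generators(1)[of "x ^ Suc (Suc k)" y]
      by (simp add: mult_ac)
    ultimately show "?J \<subseteq> ?K"
      using x integers_power[OF x(1), of "Suc k"]
      by (intro ideal2_prod_subset[OF K]) (auto simp: mult.commute[of y x])
    show "?K \<subseteq> ?J"
      using gens yJ by (intro ideal2_subset[OF J]) (auto simp: mult_ac)
  qed
  with Suc show ?case by (simp add: ideals_set_def)
qed

text \<open>This takes the place of unique factorization of ideals.\<close>

lemma ideal2_pow_eq_PIdl:
  assumes x: "x \<in> \<O>" "y \<in> \<O>" "y' \<in> \<O>" and xy: "x ^ p = y * y'"
    and cop: "u \<in> \<O>" "w \<in> \<O>" "u * y + w * y' = 1" and p: "p > 0"
  shows "ideal2 x y [^]\<^bsub>ideals_set R\<^esub> p = PIdl\<^bsub>R\<^esub> y"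
proof -
  have "ideal2 x y [^]\<^bsub>ideals_set R\<^esub> p = ideal2 (x ^ p) y"
    using ideal2_pow[OF x xy cop, of "p - 1"] p by simp
  also have "\<dots> = PIdl\<^bsub>R\<^esub> y"
  proof
    have I: "ideal (PIdl\<^bsub>R\<^esub> y) R" using D.cgenideal_ideal x by simp
    have y: "y \<in> PIdl\<^bsub>R\<^esub> y" using D.cgenideal_self x by simp
    show "ideal2 (x ^ p) y \<subseteq> PIdl\<^bsub>R\<^esub> y"
      using ideal_memI(1)[OF I y x(3)] xy y
      by (intro ideal2_subset[OF I]) (simp_all add: mult.commute)
    show "PIdl\<^bsub>R\<^esub> y \<subseteq> ideal2 (x ^ p) y"
      using x by (intro D.cgenideal_minimal ideal_ideal2 integers_power ideal2_generators)
  qed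
  finally show ?thesis .
qed

text \<open>All four products of generators are multiples of \<open>x\<close>, and the Bezout
  relation multiplied by \<open>x\<close> recovers \<open>x\<close> from \<open>y x\<close> and
  \<open>x y'\<close>. So the conjugate ideal represents the inverse class.\<close>

lemma ideal2_prod_conj:
  assumes x: "x \<in> \<O>" "y \<in> \<O>" "y' \<in> \<O>" and xy: "x ^ p = y * y'"
    and cop: "u \<in> \<O>" "w \<in> \<O>" "u * y + w * y' = 1" and p: "p > 0"
  shows "ideal2 x y \<cdot>\<^bsub>R\<^esub> ideal2 x y' = PIdl\<^bsub>R\<^esub> x"
proof
  have I: "ideal (PIdl\<^bsub>R\<^esub> x) R" using D.cgenideal_ideal x by simp
  have xI: "x \<in> PIdl\<^bsub>R\<^esub> x" using D.cgenideal_self x by simp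
  have "y * y' = x ^ (p - 1) * x" using xy p by (metis power_minus_mult)
  then have "y * y' \<in> PIdl\<^bsub>R\<^esub> x"
    using ideal_memI(1)[OF I xI integers_power[OF x(1)]] by simp
  then show "ideal2 x y \<cdot>\<^bsub>R\<^esub> ideal2 x y' \<subseteq> PIdl\<^bsub>R\<^esub> x"
    using ideal_memI(1)[OF I xI] x by (intro ideal2_prod_subset[OF I]) (auto simp: mult.commute[of x y'])
  let ?J = "ideal2 x y \<cdot>\<^bsub>R\<^esub> ideal2 x y'"
  have J: "ideal ?J R" using x by (intro D.ideal_prod_is_ideal ideal_ideal2)
  have "y * x \<in> ?J" "x * y' \<in> ?J"
    using ideal_prod.prod[of y "ideal2 x y" x "ideal2 x y'" R]
      ideal_prod.prod[of x "ideal2 x y" y' "ideal2 x y'" R]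
    by (simp_all add: ideal2_generators)
  moreover have "x = u * (y * x) + w * (x * y')"
    using arg_cong[OF cop(3), of "\<lambda>t. x * t"] by (simp add: algebra_simps)
  ultimately have "x \<in> ?J"
    using ideal_memI[OF J] cop by metis
  then show "PIdl\<^bsub>R\<^esub> x \<subseteq> ?J" using D.cgenideal_minimal[OF J] by simp
qed

end

text \<open>An even \<open>s\<close> would make 4 a square divisor, and an odd square is 1 modulo
  4.\<close>

lemma squarefree_mult_4_minus_square:
  assumes "squarefree (4 * n - s\<^sup>2 :: int)"
  shows "odd s" and "(4 * n - s\<^sup>2) mod 4 = 3"
proof -
  show odd: "odd s"
  proof
    assume "even s"
    then obtain i where "s = 2 * i" by (elim evenE)
    then have "2\<^sup>2 dvd 4 * n - s\<^sup>2" by (simp add: power_mult_distrib)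
    from squarefreeD[OF assms this] show False by simp
  qed
  then obtain i where "s = 2 * i + 1" by (elim oddE)
  then have "4 * n - s\<^sup>2 = 3 + 4 * (n - i\<^sup>2 - i - 1)"
    by (simp add: power2_eq_square algebra_simps)
  then show "(4 * n - s\<^sup>2) mod 4 = 3" by (simp only: mod_mult_self2) simp
qed

section \<open>Ideals that are p-th roots of principal ideals, and relations between their
  classes\<close>

context imaginary_quadratic
begin

text \<open>Here \<open>c ^ p\<close> is a unit times \<open>z\<close>. Units have norm 1, so
  \<open>c\<close> has norm \<open>N\<close>, at most \<open>f / 4\<close>, and is real by
  \<open>real_if_norm_le\<close>. Conjugation then fixes \<open>c ^ p\<close>, and \<open>z\<close>
  changes only by a unit.\<close>

lemma conj_associated_of_principal_root:
  assumes c: "c \<in> \<O>" and z: "z \<in> \<O>" "z \<noteq> 0" and p: "p > 0"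
    and eq: "PIdl\<^bsub>R\<^esub> c [^]\<^bsub>ideals_set R\<^esub> p = PIdl\<^bsub>R\<^esub> z"
    and norm: "(cmod z)\<^sup>2 = N ^ p" "N \<ge> 0" "4 * N \<le> of_int f"
  shows "\<exists>w\<in>\<O>. cnj z = w * z"
proof -
  have eq': "PIdl\<^bsub>R\<^esub> (c ^ p) = PIdl\<^bsub>R\<^esub> z"
    using D.PIdl_pow[of c p] eq c by (simp add: R_pow)
  obtain e where e: "e \<in> \<O>" "c ^ p = e * z"
    using D.PIdl_eqD[OF _ _ eq'] integers_power[OF c] z by auto
  obtain e' where e': "e' \<in> \<O>" "z = e' * c ^ p"
    using D.PIdl_eqD[OF _ _ eq'[symmetric]] integers_power[OF c] z by auto
  \<comment> \<open>The norms of \<open>e\<close> and \<open>e'\<close> are nonnegative integers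
    with product 1, so both are 1.\<close>
  have "e * e' = 1" using e(2) e'(2) z(2) by (metis mult.assoc mult.commute mult_cancel_right1)
  then have "(cmod e)\<^sup>2 * (cmod e')\<^sup>2 = 1"
    by (metis norm_mult norm_one one_power2 power_mult_distrib)
  moreover obtain i j where ij: "(cmod e)\<^sup>2 = of_int i" "(cmod e')\<^sup>2 = of_int j"
    using norm_Ints[OF e(1)] norm_Ints[OF e'(1)] by (auto elim!: Ints_cases)
  ultimately have "real_of_int (i * j) = of_int 1" by simp
  then have "i * j = 1" by (simp only: of_int_eq_iff)
  moreover have "i \<ge> 0" using zero_le_power2[of "cmod e"] ij(1) by simp
  ultimately have "i = 1" by (simp add: zmult_eq_1_iff)
  have "((cmod c)\<^sup>2) ^ p = (cmod (c ^ p))\<^sup>2"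
    by (simp add: norm_power mult.commute flip: power_mult)
  also have "\<dots> = N ^ p"
    using ij \<open>i = 1\<close> norm by (simp add: e(2) norm_mult power_mult_distrib)
  finally have "(cmod c)\<^sup>2 = N"
    using power_eq_imp_eq_base[of "(cmod c)\<^sup>2" p N] p norm by simp
  then have "cnj c = c" using real_if_norm_le[OF c] norm by simp
  then have "cnj z = cnj e' * c ^ p" by (subst e'(2)) simp
  also have "\<dots> = (cnj e' * e) * z" by (simp add: e(2))
  finally show ?thesis using e e' by (blast intro: integers_intros)
qed

text \<open>The root meant is the ideal \<open>(A, x)\<close>, whose \<open>p\<close>-th power is
  \<open>(x)\<close> for \<open>p > 0\<close>. Coprimality of \<open>x\<close> and its conjugate is
  stated in Bezout form, the form in which the ideal computations use it; \<open>A \<ge> 2\<close>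
  keeps \<open>x\<close> from being a unit when \<open>p > 0\<close>.\<close>

definition coprime_root :: "nat \<Rightarrow> int \<Rightarrow> complex \<Rightarrow> bool" where
  "coprime_root p A x \<longleftrightarrow> x \<in> \<O> \<and> A \<ge> 2 \<and> (cmod x)\<^sup>2 = of_int A ^ p \<and>
     (\<exists>u\<in>\<O>. \<exists>w\<in>\<O>. u * x + w * cnj x = 1)"

lemma coprime_root_cnj: "coprime_root p A x \<Longrightarrow> coprime_root p A (cnj x)"
  unfolding coprime_root_def
  by (metis add.commute complex_cnj_cnj complex_mod_cnj integers_cnj)

lemma coprime_root_nonzero: "coprime_root p A x \<Longrightarrow> x \<noteq> 0"
  by (auto simp: coprime_root_def)

text \<open>By the Bezout relation the conjugate of \<open>x\<close> is invertible modulo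
  \<open>x\<close>, so its powers can be removed one factor at a time.\<close>

lemma coprime_root_cancel:
  assumes root: "coprime_root p A x" and "z \<in> \<O>" "v \<in> \<O>" "z * cnj x ^ k = v * x"
  shows "\<exists>v\<in>\<O>. z = v * x"
  using assms(2-)
proof (induction k arbitrary: z v)
  case 0
  then show ?case by auto
next
  case (Suc k)
  obtain u w where uw: "u \<in> \<O>" "w \<in> \<O>" "u * x + w * cnj x = 1"
    using root by (auto simp: coprime_root_def)
  have x: "x \<in> \<O>" using root by (simp add: coprime_root_def)
  obtain v' where v': "v' \<in> \<O>" "z * cnj x = v' * x"
    using Suc.IH[of "z * cnj x" v] Suc.prems x by (auto simp: mult.assoc intro: integers_intros)
  have "z = z * (u * x + w * cnj x)" using uw by simp
  also have "\<dots> = (u * z) * x + w * (z * cnj x)" by (simp add: algebra_simps)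
  also have "\<dots> = (u * z + w * v') * x" by (simp add: v' algebra_simps)
  finally show ?case using Suc.prems uw v' by (blast intro: integers_intros)
qed

text \<open>Taking norms gives \<open>A ^ p dvd B ^ p\<close>, which descends to the bases.\<close>

lemma coprime_root_dvd:
  assumes x: "coprime_root p A x" and y: "(cmod y)\<^sup>2 = of_int B ^ p" and p: "p > 0"
    and v: "v \<in> \<O>" "y = v * x"
  shows "A dvd B"
proof -
  obtain i where i: "(cmod v)\<^sup>2 = of_int i" using norm_Ints[OF v(1)] by (auto elim: Ints_cases)
  have "real_of_int (B ^ p) = (cmod v)\<^sup>2 * (cmod x)\<^sup>2"
    using y by (simp add: v(2) norm_mult power_mult_distrib)
  also have "\<dots> = of_int (i * A ^ p)" using x i by (simp add: coprime_root_def)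
  finally have "B ^ p = i * A ^ p" by (simp only: of_int_eq_iff)
  then have "A ^ p dvd B ^ p" by simp
  then show ?thesis using p by (simp add: pow_divides_pow_iff)
qed

definition root_ideal :: "int \<Rightarrow> complex \<Rightarrow> complex set" where
  "root_ideal A x = ideal2 (of_int A) x"

lemma coprime_root_norm:
  assumes "coprime_root p A x"
  shows "of_int A ^ p = x * cnj x"
  using assms complex_norm_square[of x] by (simp add: coprime_root_def)

lemma root_ideal_pow:
  assumes "coprime_root p A x" "p > 0"
  shows "root_ideal A x [^]\<^bsub>ideals_set R\<^esub> p = PIdl\<^bsub>R\<^esub> x"
proof -
  obtain u w where "x \<in> \<O>" "u \<in> \<O>" "w \<in> \<O>" "u * x + w * cnj x = 1"
    using assms(1) by (auto simp: coprime_root_def)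
  then show ?thesis
    unfolding root_ideal_def
    by (intro ideal2_pow_eq_PIdl[OF integers_of_int _ integers_cnj coprime_root_norm[OF assms(1)]]
          assms(2))
qed

lemma root_ideal_prod_cnj:
  assumes "coprime_root p A x" "p > 0"
  shows "root_ideal A x \<cdot>\<^bsub>R\<^esub> root_ideal A (cnj x) = PIdl\<^bsub>R\<^esub> (of_int A)"
proof -
  obtain u w where "x \<in> \<O>" "u \<in> \<O>" "w \<in> \<O>" "u * x + w * cnj x = 1"
    using assms(1) by (auto simp: coprime_root_def)
  then show ?thesis
    unfolding root_ideal_def
    by (intro ideal2_prod_conj[OF integers_of_int _ integers_cnj coprime_root_norm[OF assms(1)]]
          assms(2))
qed

lemma root_ideal_nonzero:
  assumes "coprime_root p A x"
  shows "root_ideal A x \<in> nonzero_ideals R"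
proof -
  have "x \<in> root_ideal A x" by (simp add: root_ideal_def ideal2_generators)
  moreover have "ideal (root_ideal A x) R"
    using assms unfolding root_ideal_def
    by (intro ideal_ideal2 integers_of_int) (simp add: coprime_root_def)
  ultimately show ?thesis
    using coprime_root_nonzero[OF assms] by (auto simp: nonzero_ideals_def)
qed

abbreviation "Cl \<equiv> ideal_class_group R"
abbreviation "root_class A x \<equiv> D.ideal_class (root_ideal A x)"

lemma root_class_pow_eq_one:
  assumes "coprime_root p A x" "p > 0"
  shows "root_class A x [^]\<^bsub>Cl\<^esub> p = \<one>\<^bsub>Cl\<^esub>"
proof -
  have "PIdl\<^bsub>R\<^esub> x \<in> nonzero_ideals R"
    using D.ideal_pow_nonzero[OF root_ideal_nonzero[OF assms(1)], of p] root_ideal_pow[OF assms]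
    by simp
  moreover have "x \<in> carrier R - {\<zero>\<^bsub>R\<^esub>}"
    using assms coprime_root_nonzero by (simp add: coprime_root_def)
  ultimately show ?thesis
    unfolding D.ideal_class_pow[OF root_ideal_nonzero[OF assms(1)]] root_ideal_pow[OF assms]
    using D.ideal_class_eq_one_iff by blast
qed

text \<open>Conjugation inverts the class; this allows an exponent \<open>k\<close> above
  \<open>p / 2\<close> to be replaced by \<open>p - k\<close>.\<close>

lemma root_class_mult_cnj:
  assumes "coprime_root p A x" "p > 0"
  shows "root_class A x \<otimes>\<^bsub>Cl\<^esub> root_class A (cnj x) = \<one>\<^bsub>Cl\<^esub>"
proof -
  have "of_int A \<in> carrier R - {\<zero>\<^bsub>R\<^esub>}"
    using assms by (simp add: coprime_root_def integers_of_int)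
  moreover have nz: "root_ideal A x \<in> nonzero_ideals R" "root_ideal A (cnj x) \<in> nonzero_ideals R"
    using assms coprime_root_cnj root_ideal_nonzero by blast+
  moreover have "PIdl\<^bsub>R\<^esub> (of_int A) \<in> nonzero_ideals R"
    using D.ideal_prod_nonzero[OF nz] root_ideal_prod_cnj[OF assms] by simp
  ultimately show ?thesis
    unfolding D.class_mult[OF nz] root_ideal_prod_cnj[OF assms]
    using D.ideal_class_eq_one_iff by blast
qed

text \<open>A generator \<open>c\<close> of the product ideal satisfies
  \<open>(c)^p = (x y^k)\<close>, and \<open>x y^k\<close> has norm \<open>(A * B ^ k) ^ p\<close>.
  By \<open>small\<close>, \<open>x y^k\<close> divides its conjugate. For \<open>k = 0\<close> this
  would make \<open>x\<close> a unit; for \<open>k > 0\<close> it makes \<open>y\<close> divide the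
  conjugate of \<open>x\<close>, and norms give the divisibility of \<open>A\<close> by
  \<open>B\<close>.\<close>

lemma root_class_relation:
  assumes x: "coprime_root p A x" and y: "coprime_root p B y" and p: "p > 0"
    and small: "4 * A * B ^ k \<le> f"
    and one: "root_class A x \<otimes>\<^bsub>Cl\<^esub> root_class B y [^]\<^bsub>Cl\<^esub> k = \<one>\<^bsub>Cl\<^esub>"
  shows "k > 0 \<and> B dvd A"
proof -
  interpret I: comm_monoid "ideals_set R" by (rule D.ideals_set_is_comm_monoid)
  let ?I = "root_ideal A x" and ?J = "root_ideal B y"
  note nz = root_ideal_nonzero[OF x] root_ideal_nonzero[OF y]
  have carr: "?I \<in> carrier (ideals_set R)" "?J \<in> carrier (ideals_set R)"
    using nz by (auto simp: ideals_set_def nonzero_ideals_def)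
  have mult: "monoid.mult (ideals_set R) = ideal_prod R" by (simp add: ideals_set_def)
  have xO: "x \<in> \<O>" "y \<in> \<O>" "A \<ge> 2" "B \<ge> 2"
    and xn: "(cmod x)\<^sup>2 = of_int A ^ p" "(cmod y)\<^sup>2 = of_int B ^ p"
    using x y by (auto simp: coprime_root_def)
  define K where "K = ?I \<cdot>\<^bsub>R\<^esub> (?J [^]\<^bsub>ideals_set R\<^esub> k)"
  have K: "K \<in> nonzero_ideals R"
    unfolding K_def by (intro D.ideal_prod_nonzero D.ideal_pow_nonzero nz)
  have "D.ideal_class K = \<one>\<^bsub>Cl\<^esub>"
    using one by (simp add: K_def D.class_mult D.ideal_class_pow D.ideal_pow_nonzero nz)
  then obtain c where c: "c \<in> \<O>" "K = PIdl\<^bsub>R\<^esub> c"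
    using D.ideal_class_eq_one_iff[OF K] by auto
  have "K [^]\<^bsub>ideals_set R\<^esub> p
      = (?I [^]\<^bsub>ideals_set R\<^esub> p) \<otimes>\<^bsub>ideals_set R\<^esub> ((?J [^]\<^bsub>ideals_set R\<^esub> p) [^]\<^bsub>ideals_set R\<^esub> k)"
    using carr
    by (simp add: K_def I.nat_pow_distrib I.nat_pow_pow mult.commute flip: mult)
  also have "\<dots> = PIdl\<^bsub>R\<^esub> (x * y ^ k)"
    unfolding root_ideal_pow[OF x p] root_ideal_pow[OF y p]
    using D.PIdl_pow[of y k] D.PIdl_prod[of x "y ^ k"] xO integers_power
    by (simp add: mult R_pow)
  finally have pow: "PIdl\<^bsub>R\<^esub> c [^]\<^bsub>ideals_set R\<^esub> p = PIdl\<^bsub>R\<^esub> (x * y ^ k)"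
    by (simp add: c)
  have "(cmod (x * y ^ k))\<^sup>2 = (cmod x)\<^sup>2 * ((cmod y)\<^sup>2) ^ k"
    by (simp add: norm_mult norm_power power_mult_distrib mult.commute flip: power_mult)
  also have "\<dots> = of_int (A * B ^ k) ^ p"
    by (simp add: xn power_mult_distrib mult.commute flip: power_mult)
  finally have norm: "(cmod (x * y ^ k))\<^sup>2 = of_int (A * B ^ k) ^ p" .
  have "4 * real_of_int (A * B ^ k) = of_int (4 * A * B ^ k)" by simp
  also have "\<dots> \<le> of_int f" using small by (simp only: of_int_le_iff)
  finally have bound: "4 * real_of_int (A * B ^ k) \<le> of_int f" .
  have "real_of_int (A * B ^ k) \<ge> 0" using xO by simp
  then obtain w where w: "w \<in> \<O>" "cnj (x * y ^ k) = w * (x * y ^ k)"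
    using conj_associated_of_principal_root[OF c(1) _ _ p pow norm _ bound] xO
      coprime_root_nonzero[OF x] coprime_root_nonzero[OF y]
    by (auto intro: integers_intros)
  show ?thesis
  proof (cases k)
    case 0
    \<comment> \<open>Written in the shape of \<open>coprime_root_cancel\<close>, which then makes
      \<open>x\<close> divide 1.\<close>
    then have "1 * cnj x ^ 1 = w * x" using w by simp
    then obtain v where "v \<in> \<O>" "1 = v * x"
      using coprime_root_cancel[OF x integers_one w(1)] by metis
    then have "A dvd 1" using coprime_root_dvd[OF x, of 1 1] p by simp
    then show ?thesis using xO by simp
  next
    case (Suc l)
    \<comment> \<open>One factor \<open>y\<close> is split off on the right, so that the powers of
      its conjugate can be cancelled on the left.\<close>
    then have "cnj x * cnj y ^ k = (w * (x * y ^ l)) * y" using w by (simp add: mult_ac)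
    then obtain v where v: "v \<in> \<O>" "cnj x = v * y"
      using coprime_root_cancel[OF y integers_cnj[OF xO(1)], of "w * (x * y ^ l)" k] w xO
      by (blast intro: integers_intros)
    have "B dvd A" using coprime_root_dvd[OF y _ p v] xn by simp
    then show ?thesis using Suc by simp
  qed
qed

text \<open>Exponents of the second class up to \<open>(p - 1) / 2\<close> are excluded by the size
  bound directly; larger ones are reflected to \<open>p - k\<close> by passing to the conjugate of
  \<open>y\<close>, which has the same norm and so obeys the same bound.\<close>

lemma class_group_contains_square:
  assumes p: "Factorial_Ring.prime p" "odd p"
    and x: "coprime_root p A x" and y: "coprime_root p B y"
    and small: "4 * A * B ^ ((p - 1) div 2) \<le> f" "4 * B \<le> f" and ndvd: "\<not> B dvd A"
  shows "\<exists>H. subgroup H Cl \<and> Cl\<lparr>carrier := H\<rparr> \<cong> integer_mod_group p \<times>\<times> integer_mod_group p"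
proof -
  interpret Cl: comm_monoid Cl by (rule D.comm_monoid_ideal_class_group)
  have p0: "p > 0" using p prime_gt_0_nat by blast
  let ?X = "root_class A x" and ?Y = "root_class B y" and ?Y' = "root_class B (cnj y)"
  note y' = coprime_root_cnj[OF y]
  have carr: "?X \<in> carrier Cl" "?Y \<in> carrier Cl" "?Y' \<in> carrier Cl"
    using D.ideal_class_closed root_ideal_nonzero x y y' by blast+
  note powp = root_class_pow_eq_one[OF x p0] root_class_pow_eq_one[OF y p0]
    root_class_pow_eq_one[OF y' p0]
  have AB: "A \<ge> 2" "B \<ge> 2" using x y by (auto simp: coprime_root_def)
  have le: "4 * A * B ^ k \<le> f" if "k \<le> (p - 1) div 2" for k
  proof -
    have "4 * A * B ^ k \<le> 4 * A * B ^ ((p - 1) div 2)"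
      using AB that by (intro mult_left_mono power_increasing) auto
    with small show ?thesis by simp
  qed
  have XY: "?X \<otimes>\<^bsub>Cl\<^esub> ?Y [^]\<^bsub>Cl\<^esub> k \<noteq> \<one>\<^bsub>Cl\<^esub>" if "k < p" for k
  proof
    assume one: "?X \<otimes>\<^bsub>Cl\<^esub> ?Y [^]\<^bsub>Cl\<^esub> k = \<one>\<^bsub>Cl\<^esub>"
    show False
    proof (cases "k \<le> (p - 1) div 2")
      case True
      then show False using root_class_relation[OF x y p0 le one] ndvd by blast
    next
      case False
      define l where "l = p - k"
      have l: "l \<le> (p - 1) div 2" "k + l = p"
        using False that p(2) by (auto simp: l_def elim!: oddE)
      \<comment> \<open>A trivial factor, the \<open>k\<close>-th power of \<open>?Y\<close> times
        its inverse \<open>?Y'\<close>, is inserted and regrouped; the exponents \<open>k\<close>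
        and \<open>l\<close> of \<open>?Y'\<close> add up to \<open>p\<close>.\<close>
      have "?X \<otimes>\<^bsub>Cl\<^esub> ?Y' [^]\<^bsub>Cl\<^esub> l
          = ?X \<otimes>\<^bsub>Cl\<^esub> (?Y \<otimes>\<^bsub>Cl\<^esub> ?Y') [^]\<^bsub>Cl\<^esub> k \<otimes>\<^bsub>Cl\<^esub> ?Y' [^]\<^bsub>Cl\<^esub> l"
        using carr by (simp add: root_class_mult_cnj[OF y p0])
      also have "\<dots> = (?X \<otimes>\<^bsub>Cl\<^esub> ?Y [^]\<^bsub>Cl\<^esub> k) \<otimes>\<^bsub>Cl\<^esub> ?Y' [^]\<^bsub>Cl\<^esub> p"
        using carr by (simp add: Cl.nat_pow_distrib Cl.m_assoc Cl.nat_pow_mult l(2))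
      finally have "?X \<otimes>\<^bsub>Cl\<^esub> ?Y' [^]\<^bsub>Cl\<^esub> l = \<one>\<^bsub>Cl\<^esub>" using one powp by simp
      then show False using root_class_relation[OF x y' p0 le[OF l(1)]] ndvd by blast
    qed
  qed
  have Y: "?Y \<noteq> \<one>\<^bsub>Cl\<^esub>"
  proof
    assume "?Y = \<one>\<^bsub>Cl\<^esub>"
    \<comment> \<open>Nontriviality of \<open>?Y\<close> is the relation lemma with \<open>y\<close>
      in both places and exponent 0, where the bound reads \<open>4 * B \<le> f\<close>.\<close>
    then have "?Y \<otimes>\<^bsub>Cl\<^esub> ?Y [^]\<^bsub>Cl\<^esub> (0::nat) = \<one>\<^bsub>Cl\<^esub>" using carr by simp
    then show False using root_class_relation[OF y y p0, of 0] small by simp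
  qed
  show ?thesis
    by (rule Cl.ex_subgroup_iso_integer_mod_group_squared[OF p0 carr(1) powp(1) carr(2) powp(2)])
       (rule Cl.independent_powers[OF carr(1) powp(1) carr(2) powp(2) p(1) XY Y])
qed

text \<open>The number \<open>(s + sqrt(-f)) / 2\<close> has trace \<open>s\<close> and norm
  \<open>A ^ p\<close>. Because \<open>p \<ge> 2\<close>, the square of \<open>gcd s A\<close>
  divides \<open>f\<close>, so trace and norm are coprime integers, and a Bezout relation between
  them yields one between the number and its conjugate.\<close>

lemma coprime_rootI:
  assumes eq: "f = 4 * A ^ p - s\<^sup>2" and p: "p \<ge> 2" and A: "A \<ge> 2"
  shows "coprime_root p A (Complex (of_int s / 2) (sqrt (of_int f) / 2))"
    (is "coprime_root p A ?x")
    and "coprime s A"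
proof -
  have odd: "odd s"
    using squarefree_mult_4_minus_square(1) f_squarefree unfolding eq by blast
  have "(gcd s A)\<^sup>2 dvd A ^ p"
    using p by (meson dvd_power_le gcd_dvd2)
  then have "(gcd s A)\<^sup>2 dvd f" by (simp add: eq dvd_diff)
  then have "gcd s A dvd 1" using squarefreeD[OF f_squarefree] by blast
  then show cop: "coprime s A" by (simp only: is_unit_gcd)
  then have "coprime s (A ^ p)" by simp
  then obtain i j where ij: "i * s + j * A ^ p = 1"
    using bezout_int[of s "A ^ p"] by auto
  have x: "?x \<in> \<O>" using odd by (intro integersI[of s 1]) simp_all
  have norm: "(cmod ?x)\<^sup>2 = of_int A ^ p"
    using norm_quadratic_int[OF f_pos, of s 1] by (simp add: eq)
  have tr: "?x + cnj ?x = of_int s" by (simp add: complex_eq_iff)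
  have nm: "?x * cnj ?x = of_int (A ^ p)"
    using norm complex_norm_square[of ?x] by simp
  \<comment> \<open>The Bezout coefficients come from \<open>i * s + j * A ^ p = 1\<close> by
    writing \<open>s\<close> as the trace and \<open>A ^ p\<close> as the norm of
    \<open>?x\<close>.\<close>
  have "(of_int i + of_int j * cnj ?x) * ?x + of_int i * cnj ?x
      = of_int i * (?x + cnj ?x) + of_int j * (?x * cnj ?x)"
    by (simp only: algebra_simps)
  also have "\<dots> = of_int (i * s + j * A ^ p)" unfolding tr nm by simp
  also have "\<dots> = 1" by (simp only: ij of_int_1)
  finally show "coprime_root p A ?x"
    unfolding coprime_root_def using x A norm by (blast intro: integers_intros)
qed

end

subsection \<open>The polynomial \<open>f_q(a,b)\<close>\<close>

lemma g_poly_mult: "(a - b) * g_poly p a b = a ^ p - b ^ p"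
proof -
  have "b ^ p - a ^ p = (b - a) * (\<Sum>i<p. a ^ (p - Suc i) * b ^ i)"
    by (rule power_diff_sumr2)
  then show ?thesis by (simp add: g_poly_def algebra_simps)
qed

text \<open>By \<open>g_poly_mult\<close> the cross term of the square is
  \<open>2 (a^p - b^p) q^p\<close> up to sign; combined with \<open>2 (a^p + b^p) q^p\<close> it
  leaves \<open>4 (a q)^p\<close> or \<open>4 (b q)^p\<close>.\<close>

lemma f_poly_eq:
  fixes a b :: int and p q :: nat
  defines "d \<equiv> (a - b) * int q ^ p"
  shows "f_poly p q a b = 4 * (a * int q) ^ p - (d + g_poly p a b)\<^sup>2"
    and "f_poly p q a b = 4 * (b * int q) ^ p - (d - g_poly p a b)\<^sup>2"
proof -
  let ?g = "g_poly p a b" and ?q = "int q ^ p"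
  have dg: "d * ?g = (a ^ p - b ^ p) * ?q"
    using g_poly_mult[of a b p] by (simp add: d_def mult.assoc mult.commute mult.left_commute)
  have q2: "(a - b)\<^sup>2 * int q ^ (2 * p) = d\<^sup>2"
    by (simp add: d_def power_mult_distrib mult.commute flip: power_mult)
  have f: "f_poly p q a b = 2 * (a ^ p + b ^ p) * ?q - d\<^sup>2 - ?g\<^sup>2"
    by (simp only: f_poly_def q2)
  have plus: "(d + ?g)\<^sup>2 = d\<^sup>2 + ?g\<^sup>2 + 2 * (d * ?g)" and minus: "(d - ?g)\<^sup>2 = d\<^sup>2 + ?g\<^sup>2 - 2 * (d * ?g)"
    by (simp_all add: power2_eq_square algebra_simps)
  show "f_poly p q a b = 4 * (a * int q) ^ p - (d + ?g)\<^sup>2"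
    unfolding f plus dg by (simp add: power_mult_distrib algebra_simps)
  show "f_poly p q a b = 4 * (b * int q) ^ p - (d - ?g)\<^sup>2"
    unfolding f minus dg by (simp add: power_mult_distrib algebra_simps)
qed

lemma class_group_rank_f_poly:
  fixes a b :: int
  assumes p: "Factorial_Ring.prime p" "p \<ge> 5" and q: "q > 0" and ab: "a \<ge> 2" "b \<ge> 2"
    and small: "f_poly p q a b \<ge> 4 * a * b ^ ((p - 1) div 2) * int q ^ ((p + 1) div 2)"
    and sqf: "squarefree (f_poly p q a b)"
  defines "G \<equiv> ideal_class_group (ring_of_integers (quadratic_field (- f_poly p q a b)))"
  shows "\<exists>H. subgroup H G \<and> G\<lparr>carrier := H\<rparr> \<cong> integer_mod_group p \<times>\<times> integer_mod_group p"
proof -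
  define f where "f = f_poly p q a b"
  define A B where "A = a * int q" and "B = b * int q"
  define m where "m = (p - 1) div 2"
  define g where "g = g_poly p a b"
  define s t where "s = (a - b) * int q ^ p + g" and "t = (a - b) * int q ^ p - g"
  have odd: "odd p" using p prime_odd_nat by auto
  have AB: "A \<ge> 2" "B \<ge> 2"
    using ab q mult_mono[of 2 a 1 "int q"] mult_mono[of 2 b 1 "int q"] by (simp_all add: A_def B_def)
  have m: "m \<ge> 1" "(p + 1) div 2 = Suc m"
    using p odd by (auto simp: m_def elim!: oddE)
  have fA: "f = 4 * A ^ p - s\<^sup>2" and fB: "f = 4 * B ^ p - t\<^sup>2"
    using f_poly_eq[where a = a and b = b and p = p and q = q]
    by (simp_all add: f_def A_def B_def s_def t_def g_def)
  \<comment> \<open>With \<open>A = a q\<close> and \<open>B = b q\<close> the exponent of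
    \<open>q\<close> is \<open>1 + m\<close>, that is \<open>(p + 1) / 2\<close>, so this is the
    lower bound assumed for \<open>f\<close>.\<close>
  have small: "4 * A * B ^ m \<le> f"
    using small unfolding m(2) by (simp add: f_def A_def B_def m_def power_mult_distrib mult_ac)
  have "B ^ 1 \<le> B ^ m" using AB m by (intro power_increasing) auto
  also have "\<dots> \<le> A * B ^ m" using AB by simp
  finally have small': "4 * B \<le> f" using small by simp
  have mod4: "f mod 4 = 3"
    using squarefree_mult_4_minus_square(2) sqf[folded f_def] unfolding fA by blast
  interpret imaginary_quadratic f
    using small' AB sqf mod4 by unfold_locales (auto simp: f_def)
  have p2: "p \<ge> 2" using p by simp
  \<comment> \<open>Otherwise \<open>b\<close> divides \<open>a\<close>, hence \<open>g\<close>,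
    \<open>s\<close> and \<open>A\<close>, and coprimality of \<open>s\<close> and \<open>A\<close>
    contradicts \<open>b \<ge> 2\<close>.\<close>
  have ndvd: "\<not> B dvd A"
  proof
    assume "B dvd A"
    then have ba: "b dvd a" using q by (simp add: A_def B_def)
    \<comment> \<open>Only the term \<open>i = 0\<close> lacks a factor \<open>b\<close>; there
      \<open>a ^ (p - 1)\<close> supplies it, since \<open>p \<ge> 2\<close>.\<close>
    have "b dvd a ^ (p - 1 - i) * b ^ i" if "i < p" for i
      using ba p2 by (cases i) (auto intro: dvd_trans[OF _ dvd_power])
    then have "b dvd g" unfolding g_def g_poly_def by (auto intro: dvd_sum)
    then have "b dvd s" using ba by (simp add: s_def)
    moreover have "b dvd A" using ba by (simp add: A_def)
    ultimately have "b dvd 1"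
      using coprime_rootI(2)[OF fA p2 AB(1)] by (metis coprime_common_divisor)
    then show False using ab by simp
  qed
  show ?thesis
    using class_group_contains_square[OF p(1) odd coprime_rootI(1)[OF fA p2 AB(1)]
        coprime_rootI(1)[OF fB p2 AB(2)] small[unfolded m_def] small' ndvd]
    unfolding R_def unfolding G_def f_def .
qed

theorem proposition1:
  fixes p :: nat and c1 c2 :: real
  assumes "Factorial_Ring.prime p" and "p \<ge> 5" and "c1 > 0" and "c2 > 0"
  shows "\<exists>x0>(0::real). \<forall>x\<ge>x0.
    (\<forall>(q::nat) (a::int) (b::int).
       Factorial_Ring.prime q \<longrightarrow>
       c1 * x powr ((real p - 2) / (2 * real p * (real p - 1))) < real q \<longrightarrow>
       real q < c2 * x powr ((real p - 2) / (2 * real p * (real p - 1))) \<longrightarrow>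
       (\<forall>t\<in>{a, b}.
          1 / (2 * real p) * real q powr (real p / (real p - 2)) < of_int t \<and>
          of_int t < (1 / (2 * real p) + 1 / (2 ^ p * real p ^ p))
                       * real q powr (real p / (real p - 2))) \<longrightarrow>
       f_poly p q a b \<ge> 4 * a * b ^ ((p - 1) div 2) * int q ^ ((p + 1) div 2) \<longrightarrow>
       squarefree (f_poly p q a b) \<longrightarrow>
       (\<exists>H. subgroup H (ideal_class_group (ring_of_integers (quadratic_field (- f_poly p q a b)))) \<and>
            (ideal_class_group (ring_of_integers (quadratic_field (- f_poly p q a b))))\<lparr>carrier := H\<rparr>
              \<cong> integer_mod_group p \<times>\<times> integer_mod_group p))"
proof -
  define e where "e = (real p - 2) / (2 * real p * (real p - 1))"
  \<comment> \<open>Chosen so that \<open>c1 * x0 powr e = 2 * p\<close>; for \<open>x\<close> from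
    there on, \<open>q\<close> exceeds \<open>2 * p\<close>.\<close>
  define x0 where "x0 = (2 * real p / c1) powr (1 / e)"
  have e: "e > 0" using assms by (simp add: e_def)
  have x0: "x0 > 0" using assms by (simp add: x0_def)
  have ge2: "t \<ge> 2"
    if x: "x \<ge> x0" and q: "c1 * x powr e < real q"
      and t: "1 / (2 * real p) * real q powr (real p / (real p - 2)) < of_int t"
    for x q and t :: int
  proof -
    have "2 * real p / c1 = x0 powr e"
      using e assms by (simp add: x0_def powr_powr)
    also have "\<dots> \<le> x powr e" using x x0 e by (intro powr_mono2) auto
    finally have "2 * real p \<le> c1 * x powr e" using assms by (simp add: field_simps)
    then have qp: "2 * real p \<le> real q" using q by simp
    \<comment> \<open>The exponent \<open>p / (p - 2)\<close> is at least 1, so the lower bound for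
      \<open>a\<close> and \<open>b\<close> is at least \<open>q / (2 * p)\<close>, hence at least
      1.\<close>
    have "real q powr 1 \<le> real q powr (real p / (real p - 2))"
      using qp assms by (intro powr_mono) auto
    with qp have "2 * real p \<le> real q powr (real p / (real p - 2))" using assms by simp
    then have "1 \<le> 1 / (2 * real p) * real q powr (real p / (real p - 2))"
      using assms by (simp add: field_simps)
    with t have "1 < real_of_int t" by linarith
    then show ?thesis by simp
  qed
  show ?thesis
    unfolding e_def[symmetric]
  proof (rule exI[of _ x0], intro conjI allI impI)
    fix x :: real and q :: nat and a b :: int
    assume x: "x \<ge> x0" and q: "Factorial_Ring.prime q" "c1 * x powr e < real q"
      and ab: "\<forall>t\<in>{a, b}.
          1 / (2 * real p) * real q powr (real p / (real p - 2)) < of_int t \<and>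
          of_int t < (1 / (2 * real p) + 1 / (2 ^ p * real p ^ p))
                       * real q powr (real p / (real p - 2))"
      and f: "f_poly p q a b \<ge> 4 * a * b ^ ((p - 1) div 2) * int q ^ ((p + 1) div 2)"
        "squarefree (f_poly p q a b)"
    have "a \<ge> 2" "b \<ge> 2" using ab by (auto intro!: ge2[OF x q(2)])
    then show "\<exists>H. subgroup H (ideal_class_group (ring_of_integers (quadratic_field (- f_poly p q a b)))) \<and>
            (ideal_class_group (ring_of_integers (quadratic_field (- f_poly p q a b))))\<lparr>carrier := H\<rparr>
              \<cong> integer_mod_group p \<times>\<times> integer_mod_group p"
      using class_group_rank_f_poly[OF assms(1,2) prime_gt_0_nat[OF q(1)] _ _ f] by blast
  qed (fact x0)
qed

end
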